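(* There are constants $C,c>0$, independent of $N$ and $k$, such that for all $N\ge2$, all $k\in\{1,\ldots,N-1\}$ with $\bar x=(k-\tfrac12)p\ell^2/R$, and all $n\in\mathbb{N}_0$, $$P_N\bigl(|K(\bar x;z_1,\ldots,z_N)|\ge n\bigr)\le C\exp(-cn^3).$$
   Context: Setting. Let $R,\ell>0$ and $p\in\mathbb{N}$. $\mathcal{Z}=\mathbb{R}\times[0,2\pi R]$, with $z=x+iy$. Laughlin's function. $$\Psi_N(z_1,\ldots,z_N)=\kappa_N\prod_{j<k}\bigl(e^{z_k/R}-e^{z_j/R}\bigr)^p\exp\Bigl(-\frac{1}{2\ell^2}\sum_k x_k^2\Bigr),$$ with $\kappa_N>0$. Probability measure. $P_N$ is the probability measure on $\mathcal{Z}^N$ with density proportional to $|\Psi_N|^2$. Particle excess function. For $\bar x=(k-\tfrac12)p\ell^2/R$, $$K(\bar x;z_1,\ldots,z_N)=\#\{j:x_j\le\bar x\}-k .$$ *)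

theory Defs
  imports "HOL-Probability.Probability"
begin

text \<open>Configuration space: z :: nat => complex, only indices < N matter
  (extensional functions on {..<N}). The cylinder Z = R x [0, 2 pi R].\<close>

definition cyl :: "real \<Rightarrow> complex set" where
  "cyl R = {z. 0 \<le> Im z \<and> Im z \<le> 2 * pi * R}"

definition base_measure :: "nat \<Rightarrow> (nat \<Rightarrow> complex) measure" where
  "base_measure N = PiM {..<N} (\<lambda>_. lborel)"

text \<open>|Psi_N|^2 without the normalisation constant kappa_N (which cancels),
  restricted to Z^N.\<close>
definition laughlin_sq :: "real \<Rightarrow> real \<Rightarrow> nat \<Rightarrow> nat \<Rightarrow> (nat \<Rightarrow> complex) \<Rightarrow> real" where
  "laughlin_sq R l p N z =
     (if (\<forall>j<N. z j \<in> cyl R) then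
       (cmod (\<Prod>k<N. \<Prod>j<k. (exp (z k / of_real R) - exp (z j / of_real R)) ^ p)
        * exp (- (1 / (2 * l\<^sup>2)) * (\<Sum>k<N. (Re (z k))\<^sup>2))) ^ 2
     else 0)"

definition laughlin_unnorm :: "real \<Rightarrow> real \<Rightarrow> nat \<Rightarrow> nat \<Rightarrow> (nat \<Rightarrow> complex) measure" where
  "laughlin_unnorm R l p N = density (base_measure N) (\<lambda>z. ennreal (laughlin_sq R l p N z))"

definition laughlin_prob :: "real \<Rightarrow> real \<Rightarrow> nat \<Rightarrow> nat \<Rightarrow> (nat \<Rightarrow> complex) set \<Rightarrow> real" where
  "laughlin_prob R l p N A =
     measure (laughlin_unnorm R l p N) A / measure (laughlin_unnorm R l p N) (space (base_measure N))"

definition particle_excess :: "nat \<Rightarrow> nat \<Rightarrow> real \<Rightarrow> (nat \<Rightarrow> complex) \<Rightarrow> int" where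
  "particle_excess N k xbar z = int (card {j. j < N \<and> Re (z j) \<le> xbar}) - int k"

end

theory Submission
  imports Defs
begin

text \<open>
  Put \<open>a = p l\<^sup>2 / R\<close> and let \<open>x\<^sub>0 \<le> x\<^sub>1 \<le> \<dots>\<close> be the sorted real parts. Up to a constant, the density is
  the product of \<open>exp (- \<Sum> (a i - x\<^sub>i)\<^sup>2 / l\<^sup>2)\<close> and of the pair factors \<open>|1 - exp ((z\<^sub>i - z\<^sub>j) / R)|\<close>
  raised to the power \<open>2 p\<close>, so particle \<open>i\<close> wants to sit at the site \<open>a i\<close>. An excess of \<open>n\<close> particles to the
  left of the cut displaces a particle by about \<open>n a\<close>, and since the \<open>x\<^sub>i\<close> are sorted, about \<open>n\<close> particles
  by at least \<open>n a / 2\<close>. We push these particles back by an explicit piecewise linear map, which opens a gap behind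
  them and is a contraction by at most the factor 2 in front of them. A pair factor loses at most
  \<open>1 + exp (- d / (2 R))\<close> at distance \<open>d\<close> as long as the distance is at least half the old one, so the total loss
  is of smaller order than the energy gain \<open>n\<^sup>3\<close>, provided that no cluster of particles is nearby. To ensure the latter,
  the displaced particle is chosen extremal, with a penalty linear in the distance to the cut; a union bound over
  its possible ranks and displacements concludes the proof. An excess to the right is reflected to the left.
\<close>

text \<open>No partition function is computed or bounded. The push maps the bad set inside each
  ordering region into that same region, so it is compared with the mass of this region alone; the
  regions are disjoint, and no factor N! arises. Uniformity in N and k is a matter of counting: an
  excursion of level q (a displacement between q and q + 1 lattice spacings) drags along O(q)
  particles of higher rank and has O(q) possible positions. The obstacle is that displacements left
  of the extremal particle are unbounded, so the crowd around such a particle is controlled only by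
  a multiple of its own displacement, not by q. The gain has the same shape: pushing by a multiple
  of q gains q times the sum of the displacements. Once q exceeds a constant, crowding uses up at
  most half of the gain, term by term. The number of pushed particles is tied to n and not to q,
  because near an end of the system q may exceed the number of particles available. The remaining
  gain is of order n q^2 with q >= n - 1, hence of order n^3 and summable over q.\<close>

section \<open>Pair factors\<close>

text \<open>Both exponentials have the same argument, so their difference is purely radial: it is |s
  - t^2| with \<open>t = exp (Re w / 2)\<close> and \<open>s = exp (Re w')\<close>. From s <= t <= 1
  this is at most t (1 - s), hence at most t times the new factor. The estimate is multiplicative
  and so survives near the zero of the pair factor.\<close>

lemma cmod_one_minus_exp_le:
  fixes w w' :: complex
  assumes "Re w \<le> 0" "Im w' = Im w" "Re w' \<le> Re w / 2"
  shows "cmod (1 - exp w) \<le> (1 + exp (Re w / 2)) * cmod (1 - exp w')"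
proof -
  define t where "t = exp (Re w / 2)"
  define s where "s = exp (Re w')"
  have t: "0 < t" "t \<le> 1" and s: "0 < s" "s \<le> t"
    using assms by (auto simp: t_def s_def)
  have "Re w = Re w / 2 + Re w / 2" by simp
  hence tt: "exp (Re w) = t * t" unfolding t_def by (metis exp_add)
  have e1: "exp w = of_real (t * t) * cis (Im w)"
    by (simp only: exp_eq_polar tt)
  have e2: "exp w' = of_real s * cis (Im w)"
    using assms(2) by (simp only: exp_eq_polar s_def)
  have "1 - exp w = (1 - exp w') + of_real (s - t * t) * cis (Im w)"
    unfolding e1 e2 by (simp add: algebra_simps)
  hence "cmod (1 - exp w) \<le> cmod (1 - exp w') + cmod (of_real (s - t * t) * cis (Im w))"
    using norm_triangle_ineq by metis
  hence "cmod (1 - exp w) \<le> cmod (1 - exp w') + \<bar>s - t * t\<bar>"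
    by (simp add: norm_mult del: of_real_diff of_real_mult)
  moreover have "\<bar>s - t * t\<bar> \<le> t * (1 - s)"
  proof (cases "s \<ge> t * t")
    case True
    have "s * (1 + t) \<le> t * (1 + t)" using s t by (intro mult_right_mono) auto
    thus ?thesis using True by (simp add: algebra_simps)
  next
    case False
    have "t * t * (1 - s) \<le> 1 * t * (1 - s)"
      using s t by (intro mult_right_mono) auto
    moreover have "t * t * s \<le> 1 * s"
      using s t by (intro mult_right_mono) (auto simp: mult_le_one)
    ultimately show ?thesis using False by (simp add: algebra_simps)
  qed
  moreover have "1 - s \<le> cmod (1 - exp w')"
    using norm_triangle_ineq2[of 1 "exp w'"] by (simp add: s_def)
  hence "t * (1 - s) \<le> t * cmod (1 - exp w')" using t by (intro mult_left_mono) auto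
  ultimately show ?thesis unfolding t_def[symmetric] by (simp add: algebra_simps)
qed

text \<open>Truncated subtraction turns the first \<open>t0\<close> exponents into 0; the rest is a
  geometric series.\<close>

lemma sum_power_diff_le:
  fixes x :: real
  assumes "0 \<le> x" "x < 1"
  shows "(\<Sum>t<T. x ^ (t - t0)) \<le> t0 + 1 / (1 - x)"
proof -
  have "(\<Sum>t<T. x ^ (t - t0)) \<le> (\<Sum>t<t0 + T. x ^ (t - t0))"
    using assms by (intro sum_mono2) auto
  also have "\<dots> = (\<Sum>t<t0. x ^ (t - t0)) + (\<Sum>t<T. x ^ t)"
    by (subst lessThan_atLeast0, subst sum.atLeastLessThan_concat[of 0 t0, symmetric])
       (auto simp: lessThan_atLeast0 sum.shift_bounds_nat_ivl[of _ 0 t0 T, simplified] add.commute)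
  also have "(\<Sum>t<T. x ^ t) \<le> (\<Sum>t. x ^ t)"
    using assms by (intro sum_le_suminf summable_geometric) auto
  also have "(\<Sum>t. x ^ t) = 1 / (1 - x)" using assms by (simp add: suminf_geometric)
  finally show ?thesis by simp
qed

text \<open>Only about \<beta> / \<alpha> indices on each side of \<open>r\<close> escape the linear
  lower bound; each of them contributes at most 1, and beyond them the terms decay geometrically
  with ratio \<open>exp (- \<alpha>)\<close>.\<close>

lemma sum_exp_dist_le:
  fixes \<alpha> \<beta> :: real and N r :: nat and y :: "nat \<Rightarrow> real"
  assumes "\<alpha> > 0" "\<beta> \<ge> 0" "r < N"
  and y: "\<And>i. i < N \<Longrightarrow> y i \<ge> 0" "\<And>i. i < N \<Longrightarrow> y i \<ge> \<alpha> * \<bar>real i - real r\<bar> - \<beta>"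
  shows "(\<Sum>i<N. exp (- y i)) \<le> 2 * (\<beta> / \<alpha> + 1 + 1 / (1 - exp (- \<alpha>)))"
proof -
  define t0 where "t0 = nat \<lceil>\<beta> / \<alpha>\<rceil>"
  have t0: "\<beta> / \<alpha> \<le> t0" "t0 \<le> \<beta> / \<alpha> + 1"
    using assms by (auto simp: t0_def)
  define x where "x = exp (- \<alpha>)"
  have x: "0 \<le> x" "x < 1" using assms by (auto simp: x_def)
  define d where "d i = (if i \<le> r then r - i else i - r)" for i
  have le: "exp (- y i) \<le> x ^ (d i - t0)" if "i < N" for i
  proof -
    have d: "\<bar>real i - real r\<bar> = d i" by (auto simp: d_def)
    have "y i \<ge> real (d i - t0) * \<alpha>"
    proof (cases "d i \<le> t0")
      case True thus ?thesis using y(1)[OF that] by simp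
    next
      case False
      have "\<beta> \<le> t0 * \<alpha>" using t0 assms by (simp add: field_simps)
      thus ?thesis using y(2)[OF that] False d by (simp add: of_nat_diff algebra_simps)
    qed
    thus ?thesis unfolding x_def by (simp flip: exp_of_nat_mult)
  qed
  have "(\<Sum>i<N. exp (- y i)) \<le> (\<Sum>i<N. x ^ (d i - t0))" using le by (intro sum_mono) auto
  also have "\<dots> = (\<Sum>i\<in>{..r}. x ^ (d i - t0)) + (\<Sum>i\<in>{r<..<N}. x ^ (d i - t0))"
    using assms by (subst sum.union_disjoint[symmetric]) (auto intro!: sum.cong)
  also have "(\<Sum>i\<in>{..r}. x ^ (d i - t0)) = (\<Sum>t<Suc r. x ^ (t - t0))"
    by (rule sum.reindex_bij_witness[of _ "\<lambda>t. r - t" "\<lambda>i. r - i"]) (auto simp: d_def)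
  also have "(\<Sum>i\<in>{r<..<N}. x ^ (d i - t0)) = (\<Sum>t\<in>{0<..<N-r}. x ^ (t - t0))"
    by (rule sum.reindex_bij_witness[of _ "\<lambda>t. r + t" "\<lambda>i. i - r"]) (auto simp: d_def)
  also have "\<dots> \<le> (\<Sum>t<N-r. x ^ (t - t0))" using x by (intro sum_mono2) auto
  also have "\<dots> \<le> t0 + 1 / (1 - x)" by (rule sum_power_diff_le[OF x])
  also have "(\<Sum>t<Suc r. x ^ (t - t0)) \<le> t0 + 1 / (1 - x)" by (rule sum_power_diff_le[OF x])
  finally have "(\<Sum>i<N. exp (- y i)) \<le> 2 * (t0 + 1 / (1 - x))" by simp
  also have "2 * (t0 + 1 / (1 - x)) \<le> 2 * (\<beta> / \<alpha> + 1 + 1 / (1 - x))"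
    by (intro mult_left_mono add_right_mono t0(2)) simp
  finally show ?thesis unfolding x_def .
qed

section \<open>Extremal displacements\<close>

text \<open>The \<^term>\<open>\<delta> i\<close> are the displacements of the sorted particles to the left of the lattice sites.
  Displacements to the left of \<^term>\<open>r\<close> may be arbitrarily large and those to the right arbitrarily negative:
  such particles stay away from the excursion, and near the ends of the system they are not unlikely enough to be
  excluded. The constant 3 leaves room for the indices between \<^term>\<open>r0\<close> and \<^term>\<open>r\<close> in
  \<open>excursion_exists\<close>.\<close>

definition excursion :: "real \<Rightarrow> nat \<Rightarrow> nat \<Rightarrow> (nat \<Rightarrow> real) \<Rightarrow> nat \<Rightarrow> nat \<Rightarrow> bool" where
  "excursion a N n \<delta> r q \<longleftrightarrow> n \<le> r \<and> r < N \<and> real q * a \<le> \<delta> r \<and> \<delta> r \<le> (real q + 1) * a \<and>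
     (\<forall>i<N. r < i \<longrightarrow> \<delta> i \<le> 3 * (real q + 1) * a + a / 4 * (real i - real r)) \<and>
     (\<forall>i<r. - \<delta> i \<le> 3 * (real q + 1) * a + a / 4 * (real r - real i))"

text \<open>Among the leftward displacements right of \<^term>\<open>r0\<close> and the rightward ones left of it, maximise the
  size minus \<^term>\<open>a / 4\<close> times the distance to \<^term>\<open>r0\<close>.\<close>

lemma excursion_exists:
  fixes \<delta> :: "nat \<Rightarrow> real" and a :: real
  assumes a: "a > 0" and slope: "\<And>i j. i \<le> j \<Longrightarrow> j < N \<Longrightarrow> \<delta> j - \<delta> i \<le> a * (real j - real i)"
    and n: "1 \<le> n" "n \<le> r0" "r0 < N" and start: "\<delta> r0 \<ge> (real n - 1/2) * a"
  shows "\<exists>r q. r < N \<and> n \<le> q + 1 \<and> \<bar>real r - real r0\<bar> < 4 * (real q + 1) \<and>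
    (excursion a N n \<delta> r q \<or> excursion a N n (\<lambda>i. - \<delta> (N - 1 - i)) (N - 1 - r) q)"
proof -
  define \<phi> where "\<phi> i = (if r0 \<le> i then \<delta> i else - \<delta> i) - a / 4 * \<bar>real i - real r0\<bar>" for i
  have "Max (\<phi> ` {..<N}) \<in> \<phi> ` {..<N}" using n by (intro Max_in) auto
  then obtain r where r: "r < N" and "\<phi> r = Max (\<phi> ` {..<N})" by auto
  hence max: "\<phi> i \<le> \<phi> r" if "i < N" for i using that by simp
  define s where "s = (if r0 \<le> r then \<delta> r else - \<delta> r)"
  define q where "q = nat \<lfloor>s / a\<rfloor>"
  \<comment> \<open>Comparing the maximum with the value at \<open>r0\<close> yields both facts
    about \<open>q\<close>: the size term forces n <= q + 1, and the penalty term keeps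
    \<open>r\<close> within 4 (q + 1) of \<open>r0\<close>.\<close>
  have s: "s \<ge> (real n - 1/2) * a + a / 4 * \<bar>real r - real r0\<bar>"
    using max[of r0] start n by (simp add: \<phi>_def s_def)
  hence "s \<ge> 1 / 2 * a" using n a
    by (smt (verit) mult_right_mono divide_nonneg_nonneg zero_le_mult_iff of_nat_1 of_nat_mono field_sum_of_halves)
  hence spos: "s > 0" using a by simp
  have q: "real q * a \<le> s" "s < (real q + 1) * a"
  proof -
    have "real q = of_int \<lfloor>s / a\<rfloor>" using spos a by (simp add: q_def)
    hence "real q \<le> s / a" "s / a < real q + 1" by linarith+
    thus "real q * a \<le> s" "s < (real q + 1) * a" using a by (auto simp: field_simps)
  qed
  have nn: "0 \<le> (real n - 1/2) * a" using n a by simp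
  have "(real n - 1/2) * a < (real q + 1) * a"
    using s q a by (smt (verit) divide_nonneg_nonneg zero_le_mult_iff)
  hence nq: "n \<le> q + 1" using a by simp
  have "a / 4 * \<bar>real r - real r0\<bar> < (real q + 1) * a" using s q nn by linarith
  hence "a * \<bar>real r - real r0\<bar> < a * (4 * (real q + 1))" by (simp add: algebra_simps)
  hence near: "\<bar>real r - real r0\<bar> < 4 * (real q + 1)"
    using a by (simp only: mult_less_cancel_left_pos)
  have s3': "3 * s \<le> 3 * (real q + 1) * a" using q by linarith
  hence s3: "s \<le> 3 * (real q + 1) * a" using spos by linarith
  have s4: "a * \<bar>real r - real r0\<bar> \<le> 4 * s" using s nn by (simp add: algebra_simps)
  show ?thesis
  proof (cases "r0 \<le> r")
    case True
    have "\<delta> i \<le> 3 * (real q + 1) * a + a / 4 * (real i - real r)" if "i < N" "r < i" for i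
      proof -
      have "\<delta> i - a / 4 * (real i - real r0) \<le> s - a / 4 * (real r - real r0)"
        using max[OF that(1)] that True by (simp add: \<phi>_def s_def)
      moreover have "a / 4 * (real i - real r0) - a / 4 * (real r - real r0) = a / 4 * (real i - real r)"
        by (simp flip: right_diff_distrib)
      ultimately show ?thesis using s3 by linarith
    qed
    moreover have "- \<delta> i \<le> 3 * (real q + 1) * a + a / 4 * (real r - real i)" if "i < r" for i
    proof (cases "i < r0")
      case i: True
      hence "- \<delta> i - a / 4 * (real r0 - real i) \<le> s - a / 4 * (real r - real r0)"
        using max[of i] that True r by (simp add: \<phi>_def s_def)
      moreover have "0 \<le> a / 4 * (real r - real r0)" using a True by simp
      moreover have "a / 4 * (real r0 - real i) \<le> a / 4 * (real r - real i)"
        using True a by (intro mult_left_mono) auto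
      ultimately show ?thesis using s3 by linarith
    next
      case False
      \<comment> \<open>Between \<open>r0\<close> and \<open>r\<close> maximality bounds \<delta>
        from above only. The missing lower bound comes from sortedness: going from \<open>r\<close>
        down to \<open>i\<close>, \<delta> drops by at most a (r - r0) <= 4 s, so - \<delta> i <= 3
        s.\<close>
      have "- \<delta> i \<le> a * (real r - real i) - s" using slope[of i r] that r True by (simp add: s_def)
      moreover have "a * (real r - real i) \<le> a * (real r - real r0)"
        using False a by (intro mult_left_mono) auto
      moreover have "a * (real r - real r0) \<le> 4 * s" using s4 True by simp
      moreover have "0 \<le> a / 4 * (real r - real i)" using that a by simp
      ultimately show ?thesis using s3' by linarith
    qed
    ultimately have "excursion a N n \<delta> r q"
      using q r n True unfolding excursion_def s_def by auto
    thus ?thesis using r nq near by blast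
  next
    case False
    have low: "- \<delta> i \<le> 3 * (real q + 1) * a + a / 4 * (real r - real i)" if "i < r" for i
      proof -
      have "- \<delta> i - a / 4 * (real r0 - real i) \<le> s - a / 4 * (real r0 - real r)"
        using max[of i] that False r by (simp add: \<phi>_def s_def)
      moreover have "a / 4 * (real r0 - real i) - a / 4 * (real r0 - real r) = a / 4 * (real r - real i)"
        by (simp flip: right_diff_distrib)
      ultimately show ?thesis using s3 by linarith
    qed
    have up: "\<delta> i \<le> 3 * (real q + 1) * a + a / 4 * (real i - real r)" if "i < N" "r < i" for i
    proof (cases "r0 \<le> i")
      case i: True
      hence "\<delta> i - a / 4 * (real i - real r0) \<le> s - a / 4 * (real r0 - real r)"
        using max[of i] that False r by (simp add: \<phi>_def s_def)
      moreover have "0 \<le> a / 4 * (real r0 - real r)" using a False by simp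
      moreover have "a / 4 * (real i - real r0) \<le> a / 4 * (real i - real r)"
        using False a by (intro mult_left_mono) auto
      ultimately show ?thesis using s3 by linarith
    next
      case i: False
      have "\<delta> i \<le> a * (real i - real r) - s" using slope[of r i] that False by (simp add: s_def)
      moreover have "a * (real i - real r) \<le> a * (real r0 - real r)"
        using i a by (intro mult_left_mono) auto
      moreover have "a * (real r0 - real r) \<le> 4 * s" using s4 False by simp
      moreover have "0 \<le> a / 4 * (real i - real r)" using that a by simp
      ultimately show ?thesis using s3' by linarith
    qed
    \<comment> \<open>Here \<delta> climbs from - s at \<open>r\<close> to at least (n - 1/2) a at
      \<open>r0\<close>, with slope at most \<open>a\<close>. So the two ranks are at least 2 n - 1
      apart, which leaves at least \<open>n\<close> ranks to the right of \<open>r\<close>, as the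
      reflected excursion requires.\<close>
    have "a * (real r0 - real r) \<ge> (real n - 1/2) * a + (real n - 1/2) * a"
    proof -
      have "0 \<le> a / 4 * \<bar>real r - real r0\<bar>" using a by simp
      moreover have "\<delta> r0 + s \<le> a * (real r0 - real r)" using slope[of r r0] False n by (simp add: s_def)
      ultimately show ?thesis using start s by linarith
    qed
    hence "a * (2 * real n - 1) \<le> a * (real r0 - real r)" by (simp add: algebra_simps)
    hence "2 * real n - 1 \<le> real r0 - real r" using a by simp
    hence "n \<le> N - 1 - r" using n False by linarith
    moreover have "N - 1 - (N - 1 - r) = r" using r by simp
    moreover have "- \<delta> (N - 1 - i) \<le> 3 * (real q + 1) * a + a / 4 * (real i - real (N - 1 - r))"
      if "i < N" "N - 1 - r < i" for i
    proof -
      have "real r - real (N - 1 - i) = real i - real (N - 1 - r)" using that r by (simp add: of_nat_diff)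
      moreover have "N - 1 - i < r" using that r by linarith
      ultimately show ?thesis using low[of "N - 1 - i"] by simp
    qed
    moreover have "\<delta> (N - 1 - i) \<le> 3 * (real q + 1) * a + a / 4 * (real (N - 1 - r) - real i)"
      if "i < N - 1 - r" for i
    proof -
      have e: "real (N - 1 - i) - real r = real (N - 1 - r) - real i" using that r by (simp add: of_nat_diff)
      have "r < N - 1 - i" "N - 1 - i < N" using that r by linarith+
      thus ?thesis using up[of "N - 1 - i"] unfolding e by blast
    qed
    ultimately have "excursion a N n (\<lambda>i. - \<delta> (N - 1 - i)) (N - 1 - r) q"
      using q r False unfolding excursion_def s_def by auto
    thus ?thesis using r nq near by blast
  qed
qed

section \<open>Change of variables\<close>

text \<open>The map pushes the measure with density \<open>J\<close> forward to Lebesgue measure;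
  for a piecewise smooth bijection \<open>J\<close> is the absolute Jacobian. The integral form
  makes kinks harmless and passes to products by Fubini.\<close>

definition transports :: "('a::euclidean_space \<Rightarrow> 'a) \<Rightarrow> ('a \<Rightarrow> real) \<Rightarrow> bool" where
  "transports \<tau> J \<longleftrightarrow> \<tau> \<in> borel_measurable borel \<and> J \<in> borel_measurable borel \<and> (\<forall>x. 0 \<le> J x) \<and>
     (\<forall>g\<in>borel_measurable borel. (\<integral>\<^sup>+x. ennreal (J x) * g (\<tau> x) \<partial>lborel) = (\<integral>\<^sup>+x. g x \<partial>lborel))"

lemma transports_id: "transports (\<lambda>x. x) (\<lambda>_. 1)"
  by (simp add: transports_def)

text \<open>The shift is \<open>h\<close> up to \<open>X\<close> and decays with slope -1/2 to 0 at
  X + 2 h, so x + \<open>slide X h x\<close> has slope 1 outside the ramp and 1/2 on it.\<close>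

definition slide :: "real \<Rightarrow> real \<Rightarrow> real \<Rightarrow> real" where
  "slide X h x = min h (max 0 ((X + 2 * h - x) / 2))"

definition slide_jac :: "real \<Rightarrow> real \<Rightarrow> real \<Rightarrow> real" where
  "slide_jac X h x = (if X < x \<and> x \<le> X + 2 * h then 1 / 2 else 1)"

lemma transports_slide:
  assumes h: "h \<ge> 0"
  shows "transports (\<lambda>x. x + slide X h x) (slide_jac X h)"
  unfolding transports_def
proof (intro conjI ballI allI)
  show "(\<lambda>x. x + slide X h x) \<in> borel_measurable borel" unfolding slide_def by measurable
  show [measurable]: "slide_jac X h \<in> borel_measurable borel" unfolding slide_jac_def by measurable
  show "0 \<le> slide_jac X h x" for x by (simp add: slide_jac_def)
  fix g :: "real \<Rightarrow> ennreal" assume [measurable]: "g \<in> borel_measurable borel"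
  \<comment> \<open>The image line is cut at the images X + h and X + 2 h of the two kinks, so that
    the map is affine on each piece.\<close>
  define G1 G2 G3 where "G1 y = g y * indicator {..X + h} y" and "G2 y = g y * indicator {X + h<..X + 2 * h} y"
    and "G3 y = g y * indicator {X + 2 * h<..} y" for y
  have [measurable]: "G1 \<in> borel_measurable borel" "G2 \<in> borel_measurable borel" "G3 \<in> borel_measurable borel"
    unfolding G1_def G2_def G3_def by measurable
  have "ennreal (slide_jac X h x) * g (x + slide X h x) =
      G1 (h + 1 * x) + (ennreal \<bar>1 / 2\<bar> * G2 ((X + 2 * h) / 2 + 1 / 2 * x) + G3 x)" for x
  proof -
    consider "x \<le> X" | "X < x" "x \<le> X + 2 * h" | "X + 2 * h < x" using h by linarith
    thus ?thesis
    proof cases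
      case 1
      hence "\<not> X + h < (X + 2 * h) / 2 + 1 / 2 * x" "\<not> X + 2 * h < x" using h by (auto simp: field_simps)
      with 1 show ?thesis using h by (simp add: slide_def slide_jac_def G1_def G2_def G3_def indicator_def min_def max_def add.commute)
    next
      case 2
      have "x + slide X h x = (X + 2 * h) / 2 + 1 / 2 * x" using 2 h by (simp add: slide_def min_def max_def field_simps)
      moreover have "\<not> h + x \<le> X + h" "X + h < (X + 2 * h) / 2 + 1 / 2 * x"
        "(X + 2 * h) / 2 + 1 / 2 * x \<le> X + 2 * h"
        using 2 h by (auto simp: field_simps)
      ultimately show ?thesis using 2 by (simp add: slide_jac_def G1_def G2_def G3_def)
    next
      case 3
      hence "\<not> h + x \<le> X + h" "\<not> (X + 2 * h) / 2 + 1 / 2 * x \<le> X + 2 * h"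
        using h by (auto simp: field_simps)
      with 3 show ?thesis using h by (simp add: slide_def slide_jac_def G1_def G2_def G3_def indicator_def min_def max_def)
    qed
  qed
  hence "(\<integral>\<^sup>+x. ennreal (slide_jac X h x) * g (x + slide X h x) \<partial>lborel) =
     (\<integral>\<^sup>+x. G1 (h + 1 * x) + (ennreal \<bar>1 / 2\<bar> * G2 ((X + 2 * h) / 2 + 1 / 2 * x) + G3 x) \<partial>lborel)"
    by simp
  also have "\<dots> = (\<integral>\<^sup>+x. G1 (h + 1 * x) \<partial>lborel) +
      (ennreal \<bar>1 / 2\<bar> * (\<integral>\<^sup>+x. G2 ((X + 2 * h) / 2 + 1 / 2 * x) \<partial>lborel) + (\<integral>\<^sup>+x. G3 x \<partial>lborel))"
    by (simp add: nn_integral_add nn_integral_cmult)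
  also have "(\<integral>\<^sup>+x. G1 (h + 1 * x) \<partial>lborel) = (\<integral>\<^sup>+x. G1 x \<partial>lborel)"
    using nn_integral_real_affine[of G1 1 h] by simp
  also have "ennreal \<bar>1 / 2\<bar> * (\<integral>\<^sup>+x. G2 ((X + 2 * h) / 2 + 1 / 2 * x) \<partial>lborel) = (\<integral>\<^sup>+x. G2 x \<partial>lborel)"
    using nn_integral_real_affine[of G2 "1/2" "(X + 2 * h) / 2"] by simp
  also have "(\<integral>\<^sup>+x. G1 x \<partial>lborel) + ((\<integral>\<^sup>+x. G2 x \<partial>lborel) + (\<integral>\<^sup>+x. G3 x \<partial>lborel)) =
      (\<integral>\<^sup>+x. G1 x + (G2 x + G3 x) \<partial>lborel)"
    by (simp add: nn_integral_add)
  also have "\<dots> = (\<integral>\<^sup>+x. g x \<partial>lborel)"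
    using h by (intro nn_integral_cong) (auto simp: G1_def G2_def G3_def indicator_def)
  finally show "(\<integral>\<^sup>+x. ennreal (slide_jac X h x) * g (x + slide X h x) \<partial>lborel) = (\<integral>\<^sup>+x. g x \<partial>lborel)" .
qed

lemma transports_reflect:
  fixes \<tau> J :: "real \<Rightarrow> real"
  assumes "transports \<tau> J"
  shows "transports (\<lambda>x. c - \<tau> (c - x)) (\<lambda>x. J (c - x))"
proof -
  have [measurable]: "\<tau> \<in> borel_measurable borel" "J \<in> borel_measurable borel"
    and J: "\<And>x. 0 \<le> J x"
    and I: "\<And>g. g \<in> borel_measurable borel \<Longrightarrow>
      (\<integral>\<^sup>+x. ennreal (J x) * g (\<tau> x) \<partial>lborel) = (\<integral>\<^sup>+x. g x \<partial>lborel)"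
    using assms unfolding transports_def by auto
  have flip: "(\<integral>\<^sup>+x. g (c - x) \<partial>lborel) = (\<integral>\<^sup>+x. g x \<partial>lborel)"
    if "g \<in> borel_measurable borel" for g :: "real \<Rightarrow> ennreal"
    using nn_integral_real_affine[of g "-1" c] that by simp
  have "(\<integral>\<^sup>+x. ennreal (J (c - x)) * g (c - \<tau> (c - x)) \<partial>lborel) = (\<integral>\<^sup>+x. g x \<partial>lborel)"
    if [measurable]: "g \<in> borel_measurable borel" for g :: "real \<Rightarrow> ennreal"
  proof -
    have "(\<integral>\<^sup>+x. ennreal (J (c - x)) * g (c - \<tau> (c - x)) \<partial>lborel) =
        (\<integral>\<^sup>+x. ennreal (J x) * g (c - \<tau> x) \<partial>lborel)"
      by (rule flip[of "\<lambda>x. ennreal (J x) * g (c - \<tau> x)"]) measurable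
    also have "\<dots> = (\<integral>\<^sup>+x. g (c - x) \<partial>lborel)"
      by (rule I[of "\<lambda>x. g (c - x)"]) measurable
    also have "\<dots> = (\<integral>\<^sup>+x. g x \<partial>lborel)" by (rule flip) measurable
    finally show ?thesis .
  qed
  thus ?thesis using J unfolding transports_def by auto
qed

lemma lborel_complex: "(lborel :: complex measure) = distr (lborel \<Otimes>\<^sub>M lborel) borel (\<lambda>(x, y). Complex x y)"
proof (rule lborel_eqI)
  have m: "(\<lambda>(x, y). Complex x y) \<in> borel_measurable (lborel \<Otimes>\<^sub>M lborel)"
    unfolding Complex_eq split_beta' by measurable
  fix l u :: complex
  assume le: "\<And>b. b \<in> Basis \<Longrightarrow> l \<bullet> b \<le> u \<bullet> b"
  have lr: "Re l \<le> Re u" "Im l \<le> Im u" using le[of 1] le[of \<i>] by (auto simp: Basis_complex_def inner_complex_def)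
  have "(\<lambda>(x, y). Complex x y) -` box l u \<inter> space (lborel \<Otimes>\<^sub>M lborel) = box (Re l) (Re u) \<times> box (Im l) (Im u)"
    by (auto simp: box_def Basis_complex_def inner_complex_def space_pair_measure)
  hence "emeasure (distr (lborel \<Otimes>\<^sub>M lborel) borel (\<lambda>(x, y). Complex x y)) (box l u) =
     emeasure lborel (box (Re l) (Re u)) * emeasure lborel (box (Im l) (Im u))"
    using m by (simp add: emeasure_distr lborel.emeasure_pair_measure_Times)
  also have "\<dots> = ennreal (\<Prod>b\<in>Basis. (u - l) \<bullet> b)"
    using lr by (simp add: Basis_complex_def inner_complex_def ennreal_mult)
  finally show "emeasure (distr (lborel \<Otimes>\<^sub>M lborel) borel (\<lambda>(x, y). Complex x y)) (box l u) =
     (\<Prod>b\<in>Basis. (u - l) \<bullet> b)" .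
qed simp

lemma nn_integral_lborel_complex:
  assumes [measurable]: "g \<in> borel_measurable borel"
  shows "(\<integral>\<^sup>+z. g z \<partial>lborel) = (\<integral>\<^sup>+y. \<integral>\<^sup>+x. g (Complex x y) \<partial>lborel \<partial>lborel)"
proof -
  have m: "(\<lambda>(x, y). Complex x y) \<in> borel_measurable (lborel \<Otimes>\<^sub>M lborel)"
    unfolding Complex_eq split_beta' by measurable
  have "(\<integral>\<^sup>+z. g z \<partial>lborel) = (\<integral>\<^sup>+z. g (case z of (x, y) \<Rightarrow> Complex x y) \<partial>(lborel \<Otimes>\<^sub>M lborel))"
    unfolding lborel_complex using m by (simp add: nn_integral_distr)
  also have "\<dots> = (\<integral>\<^sup>+y. \<integral>\<^sup>+x. g (Complex x y) \<partial>lborel \<partial>lborel)"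
    using m by (subst lborel_pair.nn_integral_snd[symmetric]) (auto simp: split_beta' comp_def)
  finally show ?thesis .
qed

text \<open>For a fixed imaginary part this is the one-dimensional identity, integrated by Fubini.
  Imaginary parts are kept, so configurations stay in the cylinder.\<close>

lemma transports_complex:
  assumes "transports \<tau> J"
  shows "transports (\<lambda>z. Complex (\<tau> (Re z)) (Im z)) (\<lambda>z. J (Re z))"
proof -
  have [measurable]: "\<tau> \<in> borel_measurable borel" "J \<in> borel_measurable borel"
    and J: "\<And>x. 0 \<le> J x"
    and I: "\<And>g. g \<in> borel_measurable borel \<Longrightarrow>
      (\<integral>\<^sup>+x. ennreal (J x) * g (\<tau> x) \<partial>lborel) = (\<integral>\<^sup>+x. g x \<partial>lborel)"
    using assms unfolding transports_def by auto
  have [measurable]: "(\<lambda>z. Complex (\<tau> (Re z)) (Im z)) \<in> borel_measurable borel"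
    unfolding Complex_eq by measurable
  have [measurable]: "(\<lambda>x. Complex x y) \<in> borel_measurable borel" for y
    unfolding Complex_eq by measurable
  have "(\<integral>\<^sup>+z. ennreal (J (Re z)) * g (Complex (\<tau> (Re z)) (Im z)) \<partial>lborel) = (\<integral>\<^sup>+z. g z \<partial>lborel)"
    if [measurable]: "g \<in> borel_measurable borel" for g :: "complex \<Rightarrow> ennreal"
  proof -
    have "(\<integral>\<^sup>+z. ennreal (J (Re z)) * g (Complex (\<tau> (Re z)) (Im z)) \<partial>lborel) =
        (\<integral>\<^sup>+y. \<integral>\<^sup>+x. ennreal (J x) * g (Complex (\<tau> x) y) \<partial>lborel \<partial>lborel)"
      by (subst nn_integral_lborel_complex) simp_all
    also have "\<dots> = (\<integral>\<^sup>+y. \<integral>\<^sup>+x. g (Complex x y) \<partial>lborel \<partial>lborel)"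
      by (intro nn_integral_cong I) measurable
    finally show ?thesis by (simp add: nn_integral_lborel_complex)
  qed
  thus ?thesis using J unfolding transports_def by auto
qed

text \<open>The product map acts on each coordinate separately, so coordinates are added one at a
  time by Fubini and the Jacobians multiply.\<close>

lemma nn_integral_PiM_transports:
  assumes "finite I" and tr: "\<And>i. i \<in> I \<Longrightarrow> transports (\<tau> i) (J i)"
    and "g \<in> borel_measurable (PiM I (\<lambda>_. lborel))"
  shows "(\<integral>\<^sup>+z. ennreal (\<Prod>i\<in>I. J i (z i)) * g (\<lambda>i\<in>I. \<tau> i (z i)) \<partial>PiM I (\<lambda>_. lborel)) =
    (\<integral>\<^sup>+z. g z \<partial>PiM I (\<lambda>_. lborel))"
  using assms
proof (induction I arbitrary: g rule: finite_induct)
  case empty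
  interpret product_sigma_finite "\<lambda>_::'a. lborel :: 'b measure" by unfold_locales
  show ?case by (simp add: PiM_empty nn_integral_count_space_finite)
next
  case (insert i I)
  interpret product_sigma_finite "\<lambda>_::'a. lborel :: 'b measure" by unfold_locales
  note [measurable] = insert.prems(2)
  have J0: "0 \<le> J k x" if "k \<in> insert i I" for k x
    using insert.prems(1)[OF that] by (simp add: transports_def)
  have mt: "\<tau> k \<in> borel_measurable lborel" "J k \<in> borel_measurable lborel" if "k \<in> insert i I" for k
    using insert.prems(1)[OF that] by (simp_all add: transports_def)
  define g' where "g' x = (\<integral>\<^sup>+y. g (x(i := y)) \<partial>lborel)" for x
  have [measurable]: "g' \<in> borel_measurable (PiM I (\<lambda>_. lborel))"
    unfolding g'_def by measurable
  have map: "(\<lambda>z. \<lambda>k\<in>K. \<tau> k (z k)) \<in> measurable (PiM K (\<lambda>_. lborel)) (PiM K (\<lambda>_. lborel))"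
    if "K \<subseteq> insert i I" for K
    using that mt(1) by (intro measurable_restrict measurable_compose[OF measurable_component_singleton]) auto
  have "(\<lambda>z. \<Prod>k\<in>insert i I. J k (z k)) \<in> borel_measurable (PiM (insert i I) (\<lambda>_. lborel))"
    using mt(2) by (intro borel_measurable_prod measurable_compose[OF measurable_component_singleton]) auto
  hence "(\<integral>\<^sup>+z. ennreal (\<Prod>k\<in>insert i I. J k (z k)) * g (\<lambda>k\<in>insert i I. \<tau> k (z k)) \<partial>PiM (insert i I) (\<lambda>_. lborel)) =
    (\<integral>\<^sup>+x. \<integral>\<^sup>+y. ennreal (\<Prod>k\<in>insert i I. J k ((x(i := y)) k)) * g (\<lambda>k\<in>insert i I. \<tau> k ((x(i := y)) k)) \<partial>lborel \<partial>PiM I (\<lambda>_. lborel))"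
    using insert.hyps map[OF subset_refl] by (subst product_nn_integral_insert) auto
  also have "\<dots> = (\<integral>\<^sup>+x. ennreal (\<Prod>k\<in>I. J k (x k)) * g' (\<lambda>k\<in>I. \<tau> k (x k)) \<partial>PiM I (\<lambda>_. lborel))"
  proof (intro nn_integral_cong)
    fix x :: "'a \<Rightarrow> 'b" assume x: "x \<in> space (PiM I (\<lambda>_. lborel))"
    let ?x = "\<lambda>k\<in>I. \<tau> k (x k)"
    have x': "?x \<in> space (PiM I (\<lambda>_. lborel))" by (auto simp: space_PiM)
    have gm: "(\<lambda>y. g (?x(i := y))) \<in> borel_measurable lborel"
      using x' by measurable
    have 1: "(\<Prod>k\<in>insert i I. J k ((x(i := y)) k)) = J i y * (\<Prod>k\<in>I. J k (x k))" for y
      using insert.hyps by (simp, intro disjI2 prod.cong) auto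
    have 2: "(\<lambda>k\<in>insert i I. \<tau> k ((x(i := y)) k)) = ?x(i := \<tau> i y)" for y
      using insert.hyps by (auto simp: fun_eq_iff restrict_def)
    have "(\<integral>\<^sup>+y. ennreal (\<Prod>k\<in>insert i I. J k ((x(i := y)) k)) * g (\<lambda>k\<in>insert i I. \<tau> k ((x(i := y)) k)) \<partial>lborel) =
       (\<integral>\<^sup>+y. ennreal (\<Prod>k\<in>I. J k (x k)) * (ennreal (J i y) * g (?x(i := \<tau> i y))) \<partial>lborel)"
      unfolding 1 2 using J0 by (simp add: ennreal_mult prod_nonneg ac_simps)
    also have "\<dots> = ennreal (\<Prod>k\<in>I. J k (x k)) * (\<integral>\<^sup>+y. ennreal (J i y) * g (?x(i := \<tau> i y)) \<partial>lborel)"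
      using mt[of i] gm by (subst nn_integral_cmult) auto
    also have "(\<integral>\<^sup>+y. ennreal (J i y) * g (?x(i := \<tau> i y)) \<partial>lborel) = g' ?x"
      using insert.prems(1)[of i] gm unfolding transports_def g'_def by auto
    finally show "(\<integral>\<^sup>+y. ennreal (\<Prod>k\<in>insert i I. J k ((x(i := y)) k)) * g (\<lambda>k\<in>insert i I. \<tau> k ((x(i := y)) k)) \<partial>lborel) =
       ennreal (\<Prod>k\<in>I. J k (x k)) * g' ?x" .
  qed
  also have "\<dots> = (\<integral>\<^sup>+x. g' x \<partial>PiM I (\<lambda>_. lborel))"
    by (rule insert.IH) (use insert.prems(1) in auto)
  also have "\<dots> = (\<integral>\<^sup>+z. g z \<partial>PiM (insert i I) (\<lambda>_. lborel))"
    unfolding g'_def using insert.hyps by (subst product_nn_integral_insert) auto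
  finally show ?case .
qed

section \<open>Pushing displaced particles back\<close>

definition pair_weight :: "real \<Rightarrow> nat \<Rightarrow> nat \<Rightarrow> (nat \<Rightarrow> complex) \<Rightarrow> real" where
  "pair_weight R p N u = (\<Prod>j<N. \<Prod>i<j. cmod (1 - exp ((u i - u j) / of_real R)) ^ (2 * p))"

text \<open>Neither sortedness nor the cylinder condition is built in: the formula is also evaluated
  at reflected configurations, whose imaginary parts are negated.\<close>

definition sorted_weight :: "real \<Rightarrow> real \<Rightarrow> real \<Rightarrow> nat \<Rightarrow> nat \<Rightarrow> (nat \<Rightarrow> complex) \<Rightarrow> real" where
  "sorted_weight a l R p N u =
     exp (- (\<Sum>i<N. (a * real i - Re (u i))\<^sup>2) / l\<^sup>2) * pair_weight R p N u"

lemma pair_weight_nonneg: "0 \<le> pair_weight R p N u"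
  unfolding pair_weight_def by (intro prod_nonneg) auto

text \<open>Every pair meeting \<open>M\<close> is charged to an endpoint in \<open>M\<close>; pairs
  inside \<open>M\<close> may be charged twice.\<close>

lemma sum_pairs_le_sum_touched:
  fixes E :: "nat \<Rightarrow> nat \<Rightarrow> real"
  assumes E0: "\<And>i j. 0 \<le> E i j" and sym: "\<And>i j. E i j = E j i" and M: "M \<subseteq> {..<N}"
  shows "(\<Sum>j<N. \<Sum>i<j. if i \<in> M \<or> j \<in> M then E i j else 0) \<le> (\<Sum>i\<in>M. \<Sum>k<N. E i k)"
proof -
  define F where "F i k = (if i \<in> M then E i k else 0)" for i k
  have F0: "0 \<le> F i k" for i k using E0 by (simp add: F_def)
  have "(\<Sum>j<N. \<Sum>i<j. if i \<in> M \<or> j \<in> M then E i j else 0) \<le> (\<Sum>j<N. \<Sum>i<j. F i j + F j i)"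
    by (intro sum_mono) (auto simp: F_def E0 sym)
  also have "\<dots> = (\<Sum>j<N. \<Sum>i<N. if i < j then F i j + F j i else 0)"
    by (intro sum.cong refl sum.mono_neutral_cong_left) auto
  also have "\<dots> = (\<Sum>j<N. \<Sum>i<N. if i < j then F i j else 0) + (\<Sum>j<N. \<Sum>i<N. if i < j then F j i else 0)"
    by (subst sum.distrib[symmetric], intro sum.cong refl, subst sum.distrib[symmetric], intro sum.cong) auto
  also have "(\<Sum>j<N. \<Sum>i<N. if i < j then F i j else 0) = (\<Sum>i<N. \<Sum>j<N. if i < j then F i j else 0)"
    by (rule sum.swap)
  also have "\<dots> + (\<Sum>j<N. \<Sum>i<N. if i < j then F j i else 0) =
      (\<Sum>i<N. \<Sum>k<N. (if i < k then F i k else 0) + (if k < i then F i k else 0))"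
    by (simp add: sum.distrib)
  also have "\<dots> \<le> (\<Sum>i<N. \<Sum>k<N. F i k)"
    using F0 by (intro sum_mono) auto
  also have "\<dots> = (\<Sum>i\<in>M. \<Sum>k<N. E i k)"
    using M by (intro sum.mono_neutral_cong_right) (auto simp: F_def)
  finally show ?thesis .
qed

text \<open>Pairs outside \<open>M\<close> do not change. A touched pair loses at most the factor 1
  + e <= exp e with e = exp (- d / (2 R)) at its old distance d, and the exponents add up over the
  touched pairs.\<close>

lemma pair_weight_le:
  assumes R: "R > 0" and M: "M \<subseteq> {..<N}"
    and Im: "\<And>i. i < N \<Longrightarrow> Im (u' i) = Im (u i)"
    and fix': "\<And>i. i < N \<Longrightarrow> i \<notin> M \<Longrightarrow> u' i = u i"
    and le: "\<And>i j. i < j \<Longrightarrow> j < N \<Longrightarrow> Re (u i) \<le> Re (u j)"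
    and half: "\<And>i j. i < j \<Longrightarrow> j < N \<Longrightarrow> Re (u' j) - Re (u' i) \<ge> (Re (u j) - Re (u i)) / 2"
  shows "pair_weight R p N u \<le>
    exp (2 * real p * (\<Sum>i\<in>M. \<Sum>k<N. exp (- (\<bar>Re (u i) - Re (u k)\<bar> / (2 * R))))) * pair_weight R p N u'"
proof -
  define E where "E i k = exp (- (\<bar>Re (u i) - Re (u k)\<bar> / (2 * R)))" for i k
  define e where "e i j = (if i \<in> M \<or> j \<in> M then E i j else 0)" for i j
  define c where "c w i j = cmod (1 - exp ((w i - w j) / of_real R))" for w :: "nat \<Rightarrow> complex" and i j :: nat
  have pair: "c u i j ^ (2 * p) \<le> exp (2 * real p * e i j) * c u' i j ^ (2 * p)" if "i < j" "j < N" for i j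
  proof -
    have "c u i j \<le> exp (e i j) * c u' i j"
    proof (cases "i \<in> M \<or> j \<in> M")
      case True
      have "c u i j \<le> (1 + exp (Re ((u i - u j) / of_real R) / 2)) * c u' i j"
        unfolding c_def
      proof (rule cmod_one_minus_exp_le)
        show "Re ((u i - u j) / complex_of_real R) \<le> 0"
          using le[OF that] R by (simp add: divide_nonpos_pos)
        show "Im ((u' i - u' j) / complex_of_real R) = Im ((u i - u j) / complex_of_real R)"
          using Im that by simp
        show "Re ((u' i - u' j) / complex_of_real R) \<le> Re ((u i - u j) / complex_of_real R) / 2"
        proof -
          have "(Re (u' i) - Re (u' j)) / R \<le> ((Re (u i) - Re (u j)) / 2) / R"
            using half[OF that] R by (intro divide_right_mono) auto
          thus ?thesis by simp
        qed
      qed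
      also have "exp (Re ((u i - u j) / of_real R) / 2) = e i j"
        using True le[OF that] by (simp add: e_def E_def minus_divide_left mult.commute)
      also have "(1 + e i j) * c u' i j \<le> exp (e i j) * c u' i j"
        by (intro mult_right_mono exp_ge_add_one_self) (simp add: c_def)
      finally show ?thesis .
    next
      case False
      thus ?thesis using fix' that by (simp add: c_def e_def)
    qed
    hence "c u i j ^ (2 * p) \<le> (exp (e i j) * c u' i j) ^ (2 * p)"
      by (intro power_mono) (auto simp: c_def)
    also have "\<dots> = exp (2 * real p * e i j) * c u' i j ^ (2 * p)"
      by (simp add: power_mult_distrib flip: exp_of_nat_mult)
    finally show ?thesis .
  qed
  have c0: "0 \<le> c w i j" for w i j by (simp add: c_def)
  have "pair_weight R p N u \<le> (\<Prod>j<N. \<Prod>i<j. exp (2 * real p * e i j) * c u' i j ^ (2 * p))"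
    unfolding pair_weight_def c_def[symmetric]
    by (intro prod_mono conjI prod_nonneg zero_le_power c0) (use pair in auto)
  also have "\<dots> = exp (2 * real p * (\<Sum>j<N. \<Sum>i<j. e i j)) * pair_weight R p N u'"
    unfolding pair_weight_def c_def[symmetric]
    by (simp add: prod.distrib exp_sum sum_distrib_left)
  also have "\<dots> \<le> exp (2 * real p * (\<Sum>i\<in>M. \<Sum>k<N. E i k)) * pair_weight R p N u'"
    unfolding e_def
    by (intro mult_right_mono pair_weight_nonneg exp_le_cancel_iff[THEN iffD2] mult_left_mono
         sum_pairs_le_sum_touched M) (auto simp: E_def abs_minus_commute)
  finally show ?thesis unfolding E_def .
qed

section \<open>The sliding map, and the weight gained by applying it to an excursion\<close>

lemma slide_bounds: "h \<ge> 0 \<Longrightarrow> 0 \<le> slide X h x \<and> slide X h x \<le> h"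
  by (auto simp: slide_def)

lemma slide_left: "h \<ge> 0 \<Longrightarrow> x \<le> X \<Longrightarrow> slide X h x = h"
  by (auto simp: slide_def)

lemma slide_right: "h \<ge> 0 \<Longrightarrow> X + 2 * h \<le> x \<Longrightarrow> slide X h x = 0"
  by (auto simp: slide_def)

lemma slide_contract: "h \<ge> 0 \<Longrightarrow> x \<le> y \<Longrightarrow> slide X h y - slide X h x \<ge> - (y - x) / 2"
  unfolding slide_def min_def max_def by (auto simp: field_simps)

text \<open>Ranks below \<open>b\<close> stay put: far below the extremal rank a displacement may
  have the other sign, and moving such a particle would raise the energy. The map increases with the
  rank, so the order of the particles is kept.\<close>

definition slide_from :: "nat \<Rightarrow> real \<Rightarrow> real \<Rightarrow> nat \<Rightarrow> real \<Rightarrow> real" where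
  "slide_from b X h i x = (if b \<le> i then x + slide X h x else x)"

definition slide_from_jac :: "nat \<Rightarrow> real \<Rightarrow> real \<Rightarrow> nat \<Rightarrow> real \<Rightarrow> real" where
  "slide_from_jac b X h i x = (if b \<le> i then slide_jac X h x else 1)"

definition move :: "(nat \<Rightarrow> real \<Rightarrow> real) \<Rightarrow> (nat \<Rightarrow> complex) \<Rightarrow> nat \<Rightarrow> complex" where
  "move \<tau> u i = Complex (\<tau> i (Re (u i))) (Im (u i))"

text \<open>A moved particle with displacement \<open>D\<close> interacts appreciably with at most \<open>crowd_const a R * D\<close> others.\<close>

definition crowd_const :: "real \<Rightarrow> real \<Rightarrow> real" where
  "crowd_const a R = 40 / a + 4 * (1 + 1 / (1 - exp (- (3 * a / (8 * R))))) / a"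

text \<open>All particles moved have displacement at least \<^term>\<open>q * a / 2\<close>, and are moved towards their sites by at
  most half of it, so each move lowers the one-dimensional energy. The \<^term>\<open>n div 2\<close> particles of rank up
  to \<^term>\<open>r\<close> gain an energy of order \<open>n q\<^sup>2\<close>; the pair interactions and the Jacobian cost only
  \<open>O(q\<^sup>2)\<close>.\<close>

lemma sorted_weight_slide:
  fixes a l R :: real and u :: "nat \<Rightarrow> complex"
  assumes a: "a > 0" and l: "l > 0" and R: "R > 0"
    and le: "\<And>i j. i \<le> j \<Longrightarrow> j < N \<Longrightarrow> Re (u i) \<le> Re (u j)"
    and ex: "excursion a N n (\<lambda>i. a * real i - Re (u i)) r q"
    and q: "1 \<le> q" "n \<le> q + 1"
    and big: "2 * real p * crowd_const a R \<le> 3 * real q * a / (16 * l\<^sup>2)"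
    and m: "m = n div 2"
    and Xhb: "X = a * real r - real q * a" "h = real q * a / 4" "b = r + 1 - m"
  shows "sorted_weight a l R p N u \<le>
    exp (- ((real q)\<^sup>2 * (3 * a\<^sup>2 * real m / (32 * l\<^sup>2) - (128 * real p * crowd_const a R * a + 8)))) *
    (sorted_weight a l R p N (move (slide_from b X h) u) * (\<Prod>i<N. slide_from_jac b X h i (Re (u i))))"
proof -
  define D where "D i = a * real i - Re (u i)" for i
  have r: "n \<le> r" "r < N" and Dr: "real q * a \<le> D r"
    and up: "\<And>i. i < N \<Longrightarrow> r < i \<Longrightarrow> D i \<le> 3 * (real q + 1) * a + a / 4 * (real i - real r)"
    and low: "\<And>i. i < r \<Longrightarrow> - D i \<le> 3 * (real q + 1) * a + a / 4 * (real r - real i)"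
    using ex unfolding excursion_def D_def by auto
  have h: "h \<ge> 0" "h > 0" unfolding Xhb using a q by auto
  have mq: "2 * m \<le> n" "m \<le> q" "m \<le> r" using m q r by auto
  have qa: "a \<le> real q * a" using a q by simp
  have xr: "Re (u r) \<le> X" using Dr by (simp add: D_def Xhb)
  define v where "v i = (if b \<le> i then slide X h (Re (u i)) else 0)" for i
  define u' where "u' = move (slide_from b X h) u"
  have u': "u' i = Complex (Re (u i) + v i) (Im (u i))" for i
    by (simp add: u'_def move_def slide_from_def v_def)
  \<comment> \<open>The moved particles are \<open>A\<close>, which lie left of \<open>X\<close> and
    shift by exactly \<open>h\<close>, and \<open>P\<close>, the higher ranks caught to the left of
    the end of the ramp. That end is X + 2 h = a r - q a / 2, so particles of \<open>P\<close> are
    displaced by at least q a / 2 as well.\<close>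
  define A where "A = {b..r}"
  define P where "P = {i. r < i \<and> i < N \<and> Re (u i) \<le> X + 2 * h}"
  have AN: "A \<subseteq> {..<N}" and PN: "P \<subseteq> {..<N}" using r by (auto simp: A_def P_def)
  have fin: "finite A" "finite P" using finite_subset[OF PN] by (auto simp: A_def)
  have disj: "A \<inter> P = {}" by (auto simp: A_def P_def)
  have cardA: "card A = m" using mq by (simp add: A_def Xhb)
  have bA: "b \<le> i" if "i \<in> A \<union> P" for i using that by (auto simp: A_def P_def Xhb)

  \<comment> \<open>Sortedness lets the displacement drop by at most \<open>a\<close> per rank below
    \<open>r\<close>, and 2 (r - i) <= q since 2 m <= n <= q + 1.\<close>
  have DA: "real q * a / 2 \<le> D i" "v i = h" if "i \<in> A" for i
  proof -
    have i: "i \<le> r" "b \<le> i" using that by (auto simp: A_def)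
    have "2 * (r - i) \<le> q" using i Xhb mq q by linarith
    hence "real (2 * (r - i)) \<le> real q" by (simp only: of_nat_le_iff)
    hence "2 * (real r - real i) \<le> real q" using i by (simp add: of_nat_diff)
    hence "a * (2 * (real r - real i)) \<le> a * real q" using a by (intro mult_left_mono) auto
    hence "a * (real r - real i) \<le> real q * a / 2" by (simp add: algebra_simps)
    moreover have "D r - D i \<le> a * (real r - real i)"
      using le[OF i(1) r(2)] by (simp add: D_def algebra_simps)
    ultimately show "real q * a / 2 \<le> D i" using Dr by linarith
    show "v i = h" using i le[OF i(1) r(2)] xr h by (simp add: v_def slide_left)
  qed
  have DP: "real q * a / 2 + a * (real i - real r) \<le> D i" if "i \<in> P" for i
    using that by (simp add: P_def D_def Xhb algebra_simps)
  \<comment> \<open>Being in \<open>P\<close> forces a displacement growing with slope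
    \<open>a\<close> in the rank, while the excursion allows only slope a / 4. The two bounds cross
    at distance O(q), so \<open>P\<close> has O(q) elements.\<close>
  have P_near: "i \<le> r + 4 * q + 4" if "i \<in> P" for i
  proof -
    have "real q * a / 2 + a * (real i - real r) \<le> 3 * (real q + 1) * a + a / 4 * (real i - real r)"
      using DP[OF that] up[of i] that by (simp add: P_def)
    hence "a * (3 * (real i - real r)) \<le> a * (10 * real q + 12)" by (simp add: field_simps)
    hence "3 * (real i - real r) \<le> 10 * real q + 12" using a by simp
    moreover have "0 \<le> real q" by simp
    ultimately have "real i \<le> real r + 4 * real q + 4" by argo
    thus ?thesis by linarith
  qed
  have "P \<subseteq> {r<..r + 4 * q + 4}" using P_near by (auto simp: P_def)
  hence "card P \<le> card {r<..r + 4 * q + 4}" by (intro card_mono) auto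
  hence cardP: "card P \<le> 8 * q" using q by simp
  have DP2: "D i \<le> 8 * real q * a" if "i \<in> P" for i
  proof -
    have "real i - real r \<le> 4 * real q + 4" using P_near[OF that] by linarith
    hence "a / 4 * (real i - real r) \<le> a / 4 * (4 * real q + 4)" using a by (intro mult_left_mono) auto
    hence "D i \<le> 3 * (real q + 1) * a + a / 4 * (4 * real q + 4)"
      using up[of i] that by (simp add: P_def)
    also have "\<dots> = 4 * real q * a + 4 * a" by (simp add: field_simps)
    finally show ?thesis using qa by linarith
  qed
  have Dpos: "real q * a / 2 \<le> D i" if "i \<in> A \<union> P" for i
  proof (cases "i \<in> A")
    case False
    hence "i \<in> P" "r < i" using that by (auto simp: P_def)
    moreover from this have "0 \<le> a * (real i - real r)" using a by simp
    ultimately show ?thesis using DP[of i] by linarith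
  qed (use DA in auto)
  have fixed: "v i = 0" if "i < N" "i \<notin> A \<union> P" for i
    using that h by (auto simp: A_def P_def v_def slide_right)

  \<comment> \<open>Moving by v changes D^2 by v (2 D - v), which is nonnegative as v <= h = q a / 4
    <= D / 2. On \<open>A\<close>, where v = h, it is at least h (3/2) D = (3/8) q a D.\<close>
  have energy: "(\<Sum>i<N. (D i)\<^sup>2) - (\<Sum>i<N. (D i - v i)\<^sup>2) \<ge> 3 / 8 * real q * a * (\<Sum>i\<in>A. D i)"
  proof -
    have v: "0 \<le> v i" "v i \<le> h" for i using slide_bounds[OF h(1)] h by (auto simp: v_def)
    have "3 / 8 * real q * a * (\<Sum>i\<in>A. D i) = (\<Sum>i\<in>A. 3 / 8 * real q * a * D i)"
      by (simp add: sum_distrib_left)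
    also have "\<dots> \<le> (\<Sum>i\<in>A. v i * (2 * D i - v i))"
    proof (rule sum_mono)
      fix i assume i: "i \<in> A"
      have "h * (3 / 2 * D i) \<le> h * (2 * D i - h)"
        using DA(1)[OF i] h(1) Xhb(2) by (intro mult_left_mono) linarith+
      moreover have "3 / 8 * real q * a * D i = h * (3 / 2 * D i)" unfolding Xhb(2) by simp
      ultimately show "3 / 8 * real q * a * D i \<le> v i * (2 * D i - v i)"
        unfolding DA(2)[OF i] by linarith
    qed
    also have "\<dots> \<le> (\<Sum>i<N. v i * (2 * D i - v i))"
    proof (rule sum_mono2)
      fix i assume i: "i \<in> {..<N} - A"
      show "0 \<le> v i * (2 * D i - v i)"
      proof (cases "i \<in> P")
        case True
        have "v i \<le> real q * a / 4" using v Xhb by simp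
        moreover have "real q * a / 2 \<le> D i" using Dpos True by blast
        ultimately have "0 \<le> 2 * D i - v i" using qa a by linarith
        thus ?thesis using v by simp
      next
        case False thus ?thesis using fixed[of i] i by simp
      qed
    qed (use AN in auto)
    also have "\<dots> = (\<Sum>i<N. (D i)\<^sup>2) - (\<Sum>i<N. (D i - v i)\<^sup>2)"
      by (simp add: power2_eq_square algebra_simps flip: sum_subtractf)
    finally show ?thesis .
  qed

  define K where "K = crowd_const a R"
  have K0: "0 < 1 - exp (- (3 * a / (8 * R)))" using a R by simp
  hence Kpos: "K \<ge> 0" using a by (simp add: K_def crowd_const_def)
  have crowd: "(\<Sum>k<N. exp (- (\<bar>Re (u i) - Re (u k)\<bar> / (2 * R)))) \<le> K * D i" if i: "i \<in> A \<union> P" for i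
  proof -
    define \<beta> where "\<beta> = (3 * (real q + 1) * a + D i + a * real m) / (2 * R)"
    define \<alpha> where "\<alpha> = 3 * a / (8 * R)"
    have D: "real q * a / 2 \<le> D i" "0 \<le> D i" using Dpos[OF i] qa a by linarith+
    have xi: "Re (u i) \<le> a * real r"
    proof -
      have "Re (u i) \<le> X + 2 * h"
        using i xr h le[of i r] r by (auto simp: A_def P_def)
      thus ?thesis using Xhb(1,2) qa a by linarith
    qed
    have xi2: "a * real r - Re (u i) \<le> D i + a * real m"
    proof -
      have "real r - real i \<le> real m" using bA[OF i] Xhb mq by linarith
      hence "a * (real r - real i) \<le> a * real m" using a by (intro mult_left_mono) auto
      thus ?thesis by (simp add: D_def algebra_simps)
    qed
    \<comment> \<open>Lattice slope \<open>a\<close> minus the slope a / 4 granted to excursions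
      leaves 3 a / 4: up to a constant multiple of \<open>D i\<close>, the particles spread out
      linearly in rank, which rules out a cluster.\<close>
    have far: "3 / 4 * a * \<bar>real k - real r\<bar> - (3 * (real q + 1) * a + D i + a * real m) \<le> \<bar>Re (u i) - Re (u k)\<bar>"
      if "k < N" for k
    proof -
      have nn: "0 \<le> a * real m" "0 \<le> 3 * (real q + 1) * a" using a by auto
      consider "r < k" | "k < r" | "k = r" by linarith
      thus ?thesis
      proof cases
        case 1
        have "Re (u k) - a * real r = a * (real k - real r) - D k" by (simp add: D_def algebra_simps)
        also have "\<dots> \<ge> 3 / 4 * a * (real k - real r) - 3 * (real q + 1) * a"
          using up[OF that 1] by (simp add: field_simps)
        finally show ?thesis using xi 1 nn D by simp
      next
        case 2
        have "a * real r - Re (u k) = a * (real r - real k) + D k" by (simp add: D_def algebra_simps)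
        also have "\<dots> \<ge> 3 / 4 * a * (real r - real k) - 3 * (real q + 1) * a"
          using low[OF 2] by (simp add: field_simps)
        finally show ?thesis using xi2 2 nn D by simp
      next
        case 3
        hence "3 / 4 * a * \<bar>real k - real r\<bar> = 0" by simp
        thus ?thesis using nn D by linarith
      qed
    qed
    have "(\<Sum>k<N. exp (- (\<bar>Re (u i) - Re (u k)\<bar> / (2 * R)))) \<le> 2 * (\<beta> / \<alpha> + 1 + 1 / (1 - exp (- \<alpha>)))"
    proof (rule sum_exp_dist_le[where r = r])
      show "\<alpha> > 0" "\<beta> \<ge> 0" "r < N" using a R D r by (auto simp: \<alpha>_def \<beta>_def)
      fix k assume k: "k < N"
      show "0 \<le> \<bar>Re (u i) - Re (u k)\<bar> / (2 * R)" using R by simp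
      have "\<alpha> * \<bar>real k - real r\<bar> - \<beta> =
          (3 / 4 * a * \<bar>real k - real r\<bar> - (3 * (real q + 1) * a + D i + a * real m)) / (2 * R)"
        by (simp add: \<alpha>_def \<beta>_def diff_divide_distrib)
      also have "\<dots> \<le> \<bar>Re (u i) - Re (u k)\<bar> / (2 * R)"
        using far[OF k] R by (intro divide_right_mono) auto
      finally show "\<alpha> * \<bar>real k - real r\<bar> - \<beta> \<le> \<bar>Re (u i) - Re (u k)\<bar> / (2 * R)" .
    qed
    \<comment> \<open>With a <= q a <= 2 D and m <= q, the numerator 3 q a + 3 a + D + a m of
      \<beta> is at most (6 + 6 + 1 + 2) D; dividing by \<alpha> turns 15 / (2 R) into 20 /
      a.\<close>
    also have "\<beta> / \<alpha> \<le> 20 * D i / a"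
    proof -
      have "real m * a \<le> real q * a" using mq a by simp
      moreover have "3 * (real q + 1) * a = 3 * (real q * a) + 3 * a" "a * real m = real m * a"
        by (simp_all add: algebra_simps)
      ultimately have "3 * (real q + 1) * a + D i + a * real m \<le> 15 * D i"
        using D qa by linarith
      hence "\<beta> \<le> 15 * D i / (2 * R)" unfolding \<beta>_def using R by (intro divide_right_mono) auto
      hence "\<beta> / \<alpha> \<le> 15 * D i / (2 * R) / \<alpha>" using a R by (intro divide_right_mono) (auto simp: \<alpha>_def)
      also have "\<dots> = 20 * D i / a" using a R by (simp add: \<alpha>_def field_simps)
      finally show ?thesis .
    qed
    also have "20 * D i / a + 1 + 1 / (1 - exp (- \<alpha>)) \<le>
        20 * D i / a + (1 + 1 / (1 - exp (- \<alpha>))) * (2 * D i / a)"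
    proof -
      have "a \<le> 2 * D i" using D qa by linarith
      hence "1 \<le> 2 * D i / a" using a by simp
      hence "(1 + 1 / (1 - exp (- \<alpha>))) * 1 \<le> (1 + 1 / (1 - exp (- \<alpha>))) * (2 * D i / a)"
        using K0 by (intro mult_left_mono) (auto simp: \<alpha>_def)
      thus ?thesis by simp
    qed
    also have "2 * (20 * D i / a + (1 + 1 / (1 - exp (- \<alpha>))) * (2 * D i / a)) = K * D i"
      using a by (simp add: K_def crowd_const_def \<alpha>_def add_divide_distrib algebra_simps)
    finally show ?thesis by simp
  qed

  define L where "L = (\<Sum>i\<in>A \<union> P. \<Sum>k<N. exp (- (\<bar>Re (u i) - Re (u k)\<bar> / (2 * R))))"
  have pairs: "pair_weight R p N u \<le> exp (2 * real p * L) * pair_weight R p N u'"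
    unfolding L_def
  proof (rule pair_weight_le[OF R])
    show "A \<union> P \<subseteq> {..<N}" using AN PN by simp
    show "Im (u' i) = Im (u i)" for i by (simp add: u')
    show "u' i = u i" if "i < N" "i \<notin> A \<union> P" for i
      using fixed[OF that] by (simp add: u')
    show "Re (u i) \<le> Re (u j)" if "i < j" "j < N" for i j using le[of i j] that by simp
    \<comment> \<open>If both ranks slide, this is the slope bound of \<open>slide\<close>. If only
      the larger one does, the distance cannot shrink.\<close>
    show "(Re (u j) - Re (u i)) / 2 \<le> Re (u' j) - Re (u' i)" if "i < j" "j < N" for i j
    proof -
      have "Re (u i) \<le> Re (u j)" using le[of i j] that by simp
      moreover from slide_contract[OF h(1) this, of X]
      have "v j - v i \<ge> - (Re (u j) - Re (u i)) / 2"
        using that slide_bounds[OF h(1), of X "Re (u j)"] \<open>Re (u i) \<le> Re (u j)\<close> by (auto simp: v_def)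
      ultimately show ?thesis by (simp add: u')
    qed
  qed
  \<comment> \<open>On \<open>P\<close> displacements are at most 8 q a, giving an explicit O(q^2).
    On \<open>A\<close> they have no upper bound, so their sum is left standing, to be absorbed by
    the energy gain.\<close>
  have L: "L \<le> K * (\<Sum>i\<in>A. D i) + 64 * K * a * (real q)\<^sup>2"
  proof -
    have "L \<le> (\<Sum>i\<in>A \<union> P. K * D i)" unfolding L_def by (intro sum_mono crowd)
    also have "\<dots> = K * (\<Sum>i\<in>A. D i) + K * (\<Sum>i\<in>P. D i)"
      using fin disj by (simp add: sum.union_disjoint sum_distrib_left)
    finally have *: "L \<le> K * (\<Sum>i\<in>A. D i) + K * (\<Sum>i\<in>P. D i)" .
    have "(\<Sum>i\<in>P. D i) \<le> real (card P) * (8 * real q * a)" by (intro sum_bounded_above DP2)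
    also have "\<dots> \<le> real (8 * q) * (8 * real q * a)"
      using cardP a by (intro mult_right_mono of_nat_mono) auto
    also have "\<dots> = 64 * a * (real q)\<^sup>2" by (simp add: power2_eq_square)
    finally have "K * (\<Sum>i\<in>P. D i) \<le> K * (64 * a * (real q)\<^sup>2)"
      using Kpos by (intro mult_left_mono)
    with * show ?thesis by (simp add: algebra_simps)
  qed

  \<comment> \<open>Only particles on the ramp contract. Ranks up to \<open>r\<close> lie left of
    \<open>X\<close>, so just the at most 8 q particles of \<open>P\<close> contribute, each a
    factor 1/2 >= exp (-1).\<close>
  have jac: "(\<Prod>i<N. slide_from_jac b X h i (Re (u i))) \<ge> exp (- 8 * real q)"
  proof -
    have one: "slide_from_jac b X h i (Re (u i)) = 1" if "i < N" "i \<notin> P" for i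
    proof (cases "r < i")
      case True thus ?thesis using that by (auto simp: slide_from_jac_def slide_jac_def P_def)
    next
      case False
      hence "Re (u i) \<le> X" using le[of i r] r xr by simp
      thus ?thesis by (simp add: slide_from_jac_def slide_jac_def)
    qed
    have half: "exp (- 1) \<le> (1 / 2 :: real)"
      using exp_ge_add_one_self[of "1::real"] by (simp add: exp_minus field_simps)
    have "exp (- 8 * real q) \<le> exp (- real (card P))" using cardP by simp
    also have "\<dots> = exp (- 1) ^ card P" by (simp flip: exp_of_nat_mult)
    also have "\<dots> \<le> (1 / 2 :: real) ^ card P" using half by (intro power_mono) auto
    also have "\<dots> = (\<Prod>i\<in>P. 1 / 2)" by simp
    also have "\<dots> \<le> (\<Prod>i\<in>P. slide_from_jac b X h i (Re (u i)))"
      by (intro prod_mono) (auto simp: slide_from_jac_def slide_jac_def)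
    also have "\<dots> = (\<Prod>i<N. slide_from_jac b X h i (Re (u i)))"
      using PN one by (intro prod.mono_neutral_left) auto
    finally show ?thesis .
  qed

  define S where "S = (\<Sum>i\<in>A. D i)"
  define G where "G = 3 / 8 * real q * a * S"
  define T where "T = (real q)\<^sup>2 * (3 * a\<^sup>2 * real m / (32 * l\<^sup>2) - (128 * real p * K * a + 8))"
  have S: "S \<ge> real m * (real q * a / 2)"
    unfolding S_def using sum_bounded_below[of A "real q * a / 2" D] DA(1) cardA by simp
  \<comment> \<open>By \<open>big\<close>, crowding on \<open>A\<close> costs at most half of G /
    l^2. The other half, with S >= m q a / 2, leaves 3 a^2 m q^2 / (32 l^2).\<close>
  have expo: "- G / l\<^sup>2 + 2 * real p * L + 8 * real q \<le> - T"
  proof -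
    have l2: "l\<^sup>2 > 0" using l by simp
    have Spos: "S \<ge> 0" using S a by (smt (verit) divide_nonneg_nonneg mult_nonneg_nonneg of_nat_0_le_iff)
    have "2 * real p * L \<le> 2 * real p * (K * S + 64 * K * a * (real q)\<^sup>2)"
      using L unfolding S_def by (intro mult_left_mono) auto
    also have "\<dots> = (2 * real p * K) * S + 128 * real p * K * a * (real q)\<^sup>2"
      by (simp add: algebra_simps)
    also have "(2 * real p * K) * S \<le> (3 * real q * a / (16 * l\<^sup>2)) * S"
      using big Spos unfolding K_def by (intro mult_right_mono)
    finally have 1: "2 * real p * L \<le> 3 * real q * a / (16 * l\<^sup>2) * S + 128 * real p * K * a * (real q)\<^sup>2"
      by simp
    have "3 * real q * a / (16 * l\<^sup>2) * (real m * (real q * a / 2)) \<le> 3 * real q * a / (16 * l\<^sup>2) * S"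
      using S a by (intro mult_left_mono) auto
    hence 2: "(real q)\<^sup>2 * (3 * a\<^sup>2 * real m / (32 * l\<^sup>2)) \<le> 3 * real q * a / (16 * l\<^sup>2) * S"
      by (simp add: power2_eq_square algebra_simps)
    have 3: "G / l\<^sup>2 = 2 * (3 * real q * a / (16 * l\<^sup>2) * S)" by (simp add: G_def)
    have 4: "8 * real q \<le> 8 * (real q)\<^sup>2" using q by (simp add: power2_eq_square)
    have "T = (real q)\<^sup>2 * (3 * a\<^sup>2 * real m / (32 * l\<^sup>2)) - 128 * real p * K * a * (real q)\<^sup>2 - 8 * (real q)\<^sup>2"
      by (simp add: T_def algebra_simps)
    with 1 2 3 4 show ?thesis by linarith
  qed
  have Dv: "a * real i - Re (u' i) = D i - v i" for i by (simp add: D_def u')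
  define Y where "Y = (\<Sum>i<N. (D i - v i)\<^sup>2)"
  have W': "sorted_weight a l R p N u' = exp (- Y / l\<^sup>2) * pair_weight R p N u'"
    unfolding sorted_weight_def Dv Y_def ..
  have "sorted_weight a l R p N u = exp (- (\<Sum>i<N. (D i)\<^sup>2) / l\<^sup>2) * pair_weight R p N u"
    unfolding sorted_weight_def D_def ..
  also have "\<dots> \<le> exp (- (Y + G) / l\<^sup>2) * (exp (2 * real p * L) * pair_weight R p N u')"
  proof (intro mult_mono pairs)
    have "Y + G \<le> (\<Sum>i<N. (D i)\<^sup>2)" using energy unfolding Y_def G_def S_def by linarith
    thus "exp (- (\<Sum>i<N. (D i)\<^sup>2) / l\<^sup>2) \<le> exp (- (Y + G) / l\<^sup>2)"
      by (intro exp_le_cancel_iff[THEN iffD2] divide_right_mono) auto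
  qed (auto simp: pair_weight_nonneg)
  also have "\<dots> = exp (- G / l\<^sup>2 + 2 * real p * L + 8 * real q) * (sorted_weight a l R p N u' * exp (- 8 * real q))"
  proof -
    have "- (Y + G) / l\<^sup>2 + 2 * real p * L = (- G / l\<^sup>2 + 2 * real p * L + 8 * real q) + (- Y / l\<^sup>2 + - 8 * real q)"
      by (simp add: add_divide_distrib diff_divide_distrib)
    hence "exp (- (Y + G) / l\<^sup>2) * exp (2 * real p * L) =
        exp (- G / l\<^sup>2 + 2 * real p * L + 8 * real q) * (exp (- Y / l\<^sup>2) * exp (- 8 * real q))"
      by (simp only: exp_add[symmetric])
    thus ?thesis unfolding W' by (simp only: mult.assoc[symmetric]) (simp only: ac_simps)
  qed
  also have "\<dots> \<le> exp (- T) * (sorted_weight a l R p N u' * (\<Prod>i<N. slide_from_jac b X h i (Re (u i))))"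
    using expo jac by (intro mult_mono mult_left_mono) (auto simp: W' pair_weight_nonneg)
  finally show ?thesis unfolding T_def K_def u'_def .
qed

section \<open>Symmetries of the density, and completing the square\<close>

lemma prod_pairs_square:
  fixes F :: "nat \<Rightarrow> nat \<Rightarrow> real"
  assumes "\<And>i j. F i j = F j i"
  shows "(\<Prod>k<N. \<Prod>j<k. F k j)\<^sup>2 = (\<Prod>k<N. \<Prod>j<N. if j = k then 1 else F k j)"
proof -
  have "(\<Prod>k<N. \<Prod>j<k. F k j) = (\<Prod>k<N. \<Prod>j<N. if j < k then F k j else 1)"
    by (intro prod.cong refl prod.mono_neutral_cong_left) auto
  moreover have "\<dots> = (\<Prod>k<N. \<Prod>j<N. if k < j then F k j else 1)"
    by (subst prod.swap, intro prod.cong refl if_cong assms)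
  ultimately have "(\<Prod>k<N. \<Prod>j<k. F k j)\<^sup>2 =
      (\<Prod>k<N. \<Prod>j<N. if j < k then F k j else 1) * (\<Prod>k<N. \<Prod>j<N. if k < j then F k j else 1)"
    by (simp add: power2_eq_square)
  also have "\<dots> = (\<Prod>k<N. \<Prod>j<N. if j = k then 1 else F k j)"
    by (subst prod.distrib[symmetric], intro prod.cong refl, subst prod.distrib[symmetric], intro prod.cong) auto
  finally show ?thesis .
qed

text \<open>The product over j < k is not visibly symmetric, but its square runs over all ordered
  pairs off the diagonal, which a permutation merely rearranges.\<close>

lemma laughlin_sq_permute:
  assumes g: "g permutes {..<N}"
  shows "laughlin_sq R l p N (z \<circ> g) = laughlin_sq R l p N z"
proof -
  define c where "c i j = cmod (exp (z i / of_real R) - exp (z j / of_real R)) ^ p" for i j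
  have csym: "c i j = c j i" for i j by (simp add: c_def norm_minus_commute)
  have in_cyl: "(\<forall>j<N. z (g j) \<in> cyl R) \<longleftrightarrow> (\<forall>j<N. z j \<in> cyl R)"
    using permutes_in_image[OF g] permutes_surj[OF g] by (metis lessThan_iff surjD)
  have "(\<Prod>k<N. \<Prod>j<k. c (g k) (g j))\<^sup>2 = (\<Prod>k<N. \<Prod>j<N. if j = k then 1 else c (g k) (g j))"
    by (rule prod_pairs_square) (rule csym)
  also have "\<dots> = (\<Prod>k<N. \<Prod>j<N. if g j = g k then 1 else c (g k) (g j))"
    using permutes_inj[OF g] by (intro prod.cong refl) (auto dest: injD)
  also have "\<dots> = (\<Prod>k<N. \<Prod>j<N. if j = g k then 1 else c (g k) j)"
    using prod.permute[OF g, of "\<lambda>j. if j = g k then 1 else c (g k) j" for k]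
    by (auto simp: comp_def)
  also have "\<dots> = (\<Prod>k<N. \<Prod>j<N. if j = k then 1 else c k j)"
    using prod.permute[OF g, of "\<lambda>k. \<Prod>j<N. if j = k then 1 else c k j"] by (simp add: comp_def)
  also have "\<dots> = (\<Prod>k<N. \<Prod>j<k. c k j)\<^sup>2"
    by (rule prod_pairs_square[symmetric]) (rule csym)
  finally have P: "(\<Prod>k<N. \<Prod>j<k. c (g k) (g j))\<^sup>2 = (\<Prod>k<N. \<Prod>j<k. c k j)\<^sup>2" .
  have S: "(\<Sum>k<N. (Re (z (g k)))\<^sup>2) = (\<Sum>k<N. (Re (z k))\<^sup>2)"
    using sum.permute[OF g, of "\<lambda>k. (Re (z k))\<^sup>2"] by (simp add: comp_def)
  show ?thesis
    unfolding laughlin_sq_def comp_def in_cyl S power_mult_distrib prod_norm[symmetric] norm_power c_def[symmetric] P ..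
qed

text \<open>From each pair the exponential with the larger index is factored out, so exp (z k / R)
  comes out \<open>k\<close> times per power. This produces the linear term 2 a k x_k / l^2, and
  completing the square puts the Gaussian of particle \<open>k\<close> at a k.\<close>

lemma laughlin_sq_eq_sorted_weight:
  assumes R: "R > 0" and l: "l > 0" and a: "a = real p * l\<^sup>2 / R" and z: "\<forall>j<N. z j \<in> cyl R"
  shows "laughlin_sq R l p N z = exp ((\<Sum>i<N. (a * real i)\<^sup>2) / l\<^sup>2) * sorted_weight a l R p N z"
proof -
  define c where "c i j = cmod (1 - exp ((z i - z j) / of_real R))" for i j
  define x where "x i = Re (z i)" for i
  have fac: "cmod ((exp (z k / of_real R) - exp (z j / of_real R)) ^ p) ^ 2 = exp (2 * real p * x k / R) * c j k ^ (2 * p)"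
    for j k
  proof -
    have "exp (z k / of_real R) - exp (z j / of_real R) = exp (z k / of_real R) * (1 - exp ((z j - z k) / of_real R))"
      by (simp add: right_diff_distrib diff_divide_distrib flip: exp_add)
    hence "cmod (exp (z k / of_real R) - exp (z j / of_real R)) = exp (x k / R) * c j k"
      by (simp add: norm_mult c_def x_def)
    hence "cmod ((exp (z k / of_real R) - exp (z j / of_real R)) ^ p) ^ 2 = (exp (x k / R) * c j k) ^ (2 * p)"
      by (simp add: norm_power mult.commute flip: power_mult)
    also have "\<dots> = exp (2 * real p * x k / R) * c j k ^ (2 * p)"
      by (simp add: power_mult_distrib flip: exp_of_nat_mult)
    finally show ?thesis .
  qed
  have "laughlin_sq R l p N z =
      (\<Prod>k<N. \<Prod>j<k. cmod ((exp (z k / of_real R) - exp (z j / of_real R)) ^ p) ^ 2) *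
      exp (- (1 / (2 * l\<^sup>2)) * (\<Sum>k<N. (x k)\<^sup>2)) ^ 2"
    unfolding laughlin_sq_def x_def using z by (simp add: power_mult_distrib prod_power_distrib flip: prod_norm)
  also have "(\<Prod>k<N. \<Prod>j<k. cmod ((exp (z k / of_real R) - exp (z j / of_real R)) ^ p) ^ 2) =
      exp (\<Sum>k<N. real k * (2 * real p * x k / R)) * pair_weight R p N z"
    unfolding fac pair_weight_def c_def by (simp add: prod.distrib exp_sum flip: exp_of_nat_mult)
  also have "exp (- (1 / (2 * l\<^sup>2)) * (\<Sum>k<N. (x k)\<^sup>2)) ^ 2 = exp (- (\<Sum>k<N. (x k)\<^sup>2) / l\<^sup>2)"
    by (simp flip: exp_of_nat_mult)
  also have "exp (\<Sum>k<N. real k * (2 * real p * x k / R)) * pair_weight R p N z * exp (- (\<Sum>k<N. (x k)\<^sup>2) / l\<^sup>2) =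
      exp ((\<Sum>k<N. real k * (2 * real p * x k / R)) - (\<Sum>k<N. (x k)\<^sup>2) / l\<^sup>2) * pair_weight R p N z"
    by (simp add: exp_diff exp_minus divide_inverse)
  also have "(\<Sum>k<N. real k * (2 * real p * x k / R)) - (\<Sum>k<N. (x k)\<^sup>2) / l\<^sup>2 =
      (\<Sum>k<N. (a * real k)\<^sup>2) / l\<^sup>2 + - (\<Sum>k<N. (a * real k - x k)\<^sup>2) / l\<^sup>2"
  proof -
    have "real k * (2 * real p * x k / R) - (x k)\<^sup>2 / l\<^sup>2 = (a * real k)\<^sup>2 / l\<^sup>2 - (a * real k - x k)\<^sup>2 / l\<^sup>2" for k
    proof -
      have "real k * (2 * real p * x k / R) = 2 * a * real k * x k / l\<^sup>2"
        using R l by (simp add: a field_simps)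
      moreover have "(a * real k)\<^sup>2 / l\<^sup>2 - (a * real k - x k)\<^sup>2 / l\<^sup>2 = 2 * a * real k * x k / l\<^sup>2 - (x k)\<^sup>2 / l\<^sup>2"
        by (simp add: power2_eq_square algebra_simps flip: diff_divide_distrib)
      ultimately show ?thesis by simp
    qed
    thus ?thesis by (simp add: sum_divide_distrib flip: sum_subtractf)
  qed
  finally show ?thesis unfolding sorted_weight_def x_def exp_add by simp
qed

lemma sorted_weight_cong:
  assumes "\<And>i. i < N \<Longrightarrow> u i = u' i"
  shows "sorted_weight a l R p N u = sorted_weight a l R p N u'"
  unfolding sorted_weight_def pair_weight_def using assms by (auto intro!: prod.cong arg_cong2[where f = "(*)"] sum.cong)

text \<open>Point reflection through the centre of the lattice with ranks reversed. Subtracting the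
  whole complex number keeps each difference of a lower and a higher rank, not just its real part,
  so the pair factors are only permuted.\<close>

definition reflect_config :: "real \<Rightarrow> nat \<Rightarrow> (nat \<Rightarrow> complex) \<Rightarrow> nat \<Rightarrow> complex" where
  "reflect_config a N u i = of_real (a * (real N - 1)) - u (N - 1 - i)"

lemma sorted_weight_reflect: "sorted_weight a l R p N (reflect_config a N u) = sorted_weight a l R p N u"
proof -
  have "(\<Sum>i<N. (a * real i - Re (reflect_config a N u i))\<^sup>2) = (\<Sum>i<N. (a * real i - Re (u i))\<^sup>2)"
  proof (rule sum.reindex_bij_witness[of _ "\<lambda>i. N - 1 - i" "\<lambda>i. N - 1 - i"])
    fix i assume "i \<in> {..<N}"
    hence "a * real (N - 1 - i) - Re (u (N - 1 - i)) = - (a * real i - Re (reflect_config a N u i))"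
      by (simp add: reflect_config_def of_nat_diff algebra_simps)
    thus "(a * real (N - 1 - i) - Re (u (N - 1 - i)))\<^sup>2 = (a * real i - Re (reflect_config a N u i))\<^sup>2"
      by (simp only: power2_minus)
  qed auto
  moreover have "pair_weight R p N (reflect_config a N u) = pair_weight R p N u"
    unfolding pair_weight_def
    by (subst (1 2) prod.Sigma, simp, simp,
        rule prod.reindex_bij_witness[of _ "\<lambda>(j, i). (N - 1 - i, N - 1 - j)" "\<lambda>(j, i). (N - 1 - i, N - 1 - j)"])
       (auto simp: reflect_config_def)
  ultimately show ?thesis unfolding sorted_weight_def by simp
qed

section \<open>Sorting\<close>

text \<open>Ties are broken by the index, so that the sorting permutation is unique.\<close>

definition lex_less :: "(nat \<Rightarrow> real) \<Rightarrow> nat \<Rightarrow> nat \<Rightarrow> bool" where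
  "lex_less x i j \<longleftrightarrow> x i < x j \<or> (x i = x j \<and> i < j)"

definition lex_rank :: "nat \<Rightarrow> (nat \<Rightarrow> real) \<Rightarrow> nat \<Rightarrow> nat" where
  "lex_rank N x i = card {j. j < N \<and> lex_less x j i}"

lemma lex_rank_mono:
  assumes "lex_less x i j" "i < N"
  shows "lex_rank N x i < lex_rank N x j"
proof -
  have "{k. k < N \<and> lex_less x k i} \<subset> {k. k < N \<and> lex_less x k j}"
    using assms by (auto simp: lex_less_def)
  thus ?thesis unfolding lex_rank_def by (intro psubset_card_mono) auto
qed

lemma lex_less_iff_rank:
  assumes "i < N" "j < N"
  shows "lex_less x i j \<longleftrightarrow> lex_rank N x i < lex_rank N x j"
proof -
  have "lex_less x i j \<or> i = j \<or> lex_less x j i" by (auto simp: lex_less_def)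
  thus ?thesis using lex_rank_mono[of x i j N] lex_rank_mono[of x j i N] assms by auto
qed

lemma lex_rank_inj: "inj_on (lex_rank N x) {..<N}"
proof (rule inj_onI)
  fix i j assume "i \<in> {..<N}" "j \<in> {..<N}" "lex_rank N x i = lex_rank N x j"
  hence "\<not> lex_less x i j" "\<not> lex_less x j i" by (simp_all add: lex_less_iff_rank)
  thus "i = j" by (auto simp: lex_less_def)
qed

text \<open>Ranks are injective and lie below \<open>N\<close>, hence form a bijection of the
  labels; its inverse is the sorting.\<close>

lemma ex_lex_sorting:
  "\<exists>g. g permutes {..<N} \<and> (\<forall>i j. i < j \<longrightarrow> j < N \<longrightarrow> lex_less x (g i) (g j))"
proof -
  have "lex_rank N x ` {..<N} \<subseteq> {..<N}"
  proof safe
    fix i assume "i < N"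
    hence "{k. k < N \<and> lex_less x k i} \<subset> {..<N}" by (auto simp: lex_less_def)
    from psubset_card_mono[OF _ this] show "lex_rank N x i < N" by (simp add: lex_rank_def)
  qed
  hence bij: "bij_betw (lex_rank N x) {..<N} {..<N}"
    using lex_rank_inj by (metis bij_betw_def endo_inj_surj finite_lessThan)
  define g where "g i = (if i < N then the_inv_into {..<N} (lex_rank N x) i else i)" for i
  have "bij_betw (the_inv_into {..<N} (lex_rank N x)) {..<N} {..<N}"
    by (rule bij_betw_the_inv_into[OF bij])
  hence "bij_betw g {..<N} {..<N}" by (rule bij_betw_cong[THEN iffD1, rotated]) (simp add: g_def)
  hence perm: "g permutes {..<N}" by (intro bij_imp_permutes) (auto simp: g_def)
  have rank: "lex_rank N x (g i) = i" "g i < N" if "i < N" for i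
    using that f_the_inv_into_f_bij_betw[OF bij, of i] permutes_in_image[OF perm, of i] by (auto simp: g_def)
  have "lex_less x (g i) (g j)" if "i < j" "j < N" for i j
    using that rank[of i] rank[of j] by (simp add: lex_less_iff_rank)
  thus ?thesis using perm by blast
qed

text \<open>A sorting must place at position i the label with exactly i predecessors.\<close>

lemma lex_sorting_unique:
  assumes "g permutes {..<N}" "\<forall>i j. i < j \<longrightarrow> j < N \<longrightarrow> lex_less x (g i) (g j)"
    and "g' permutes {..<N}" "\<forall>i j. i < j \<longrightarrow> j < N \<longrightarrow> lex_less x (g' i) (g' j)"
  shows "g = g'"
proof -
  have rank: "lex_rank N x (f i) = i"
    if f: "f permutes {..<N}" and s: "\<forall>i j. i < j \<longrightarrow> j < N \<longrightarrow> lex_less x (f i) (f j)" and i: "i < N" for f i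
  proof -
    have "{k. k < N \<and> lex_less x k (f i)} = f ` {..<i}"
    proof (intro equalityI subsetI)
      fix k assume "k \<in> {k. k < N \<and> lex_less x k (f i)}"
      moreover then obtain j where j: "k = f j" "j < N"
        using permutes_surj[OF f] permutes_in_image[OF f] by (metis lessThan_iff mem_Collect_eq surjD)
      ultimately have "lex_less x (f j) (f i)" by simp
      hence "j < i" using s i j by (metis lex_less_def not_less_iff_gr_or_eq less_asym)
      thus "k \<in> f ` {..<i}" using j by auto
    next
      fix k assume "k \<in> f ` {..<i}"
      thus "k \<in> {k. k < N \<and> lex_less x k (f i)}"
        using s i permutes_in_image[OF f] by auto
    qed
    thus ?thesis using permutes_inj_on[OF f, of "{..<i}"] by (simp add: lex_rank_def card_image)
  qed
  show ?thesis
  proof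
    fix i
    show "g i = g' i"
    proof (cases "i < N")
      case True
      hence "g i < N" "g' i < N" using permutes_in_image[OF assms(1), of i] permutes_in_image[OF assms(3), of i] by auto
      thus ?thesis using rank[OF assms(1,2) True] rank[OF assms(3,4) True] lex_rank_inj[of N x]
        by (metis inj_onD lessThan_iff)
    next
      case False
      thus ?thesis using assms(1,3) by (simp add: permutes_def)
    qed
  qed
qed

section \<open>Ordering regions, and change of variables inside one region\<close>

definition sorted_region :: "nat \<Rightarrow> (nat \<Rightarrow> nat) \<Rightarrow> (nat \<Rightarrow> complex) set" where
  "sorted_region N g = {z \<in> space (base_measure N). \<forall>j<N. \<forall>i<j. lex_less (\<lambda>k. Re (z k)) (g i) (g j)}"

lemma measurable_Re_component:
  "i < N \<Longrightarrow> (\<lambda>z. Re (z i)) \<in> borel_measurable (base_measure N)"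
  unfolding base_measure_def by measurable

lemma sets_sorted_region [measurable]:
  assumes g: "g permutes {..<N}"
  shows "sorted_region N g \<in> sets (base_measure N)"
proof -
  have gN: "g i < N" if "i < N" for i using permutes_in_image[OF g] that by auto
  have "sorted_region N g = {z \<in> space (base_measure N). \<forall>j\<in>{..<N}. \<forall>i\<in>{..<j}.
      Re (z (g i)) < Re (z (g j)) \<or> (Re (z (g i)) = Re (z (g j)) \<and> g i < g j)}"
    by (auto simp: sorted_region_def lex_less_def)
  also have "\<dots> \<in> sets (base_measure N)"
    using gN by (intro sets.sets_Collect_finite_All sets.sets_Collect borel_measurable_less borel_measurable_eq
      measurable_Re_component finite_lessThan) auto
  finally show ?thesis .
qed

lemma measurable_laughlin_sq [measurable]: "laughlin_sq R l p N \<in> borel_measurable (base_measure N)"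
proof -
  have [measurable]: "(\<lambda>z. z i) \<in> borel_measurable (base_measure N)" if "i < N" for i
    using that measurable_component_singleton[of i "{..<N}" "\<lambda>_. lborel :: complex measure"]
    by (simp add: base_measure_def)
  have cyl: "closed (cyl R)"
    unfolding cyl_def by (intro closed_Collect_conj closed_Collect_le continuous_intros)
  have 1: "{z \<in> space (base_measure N). \<forall>j<N. z j \<in> cyl R} \<in> sets (base_measure N)"
  proof -
    have "{z \<in> space (base_measure N). \<forall>j\<in>{..<N}. z j \<in> cyl R} \<in> sets (base_measure N)"
    proof (intro sets.sets_Collect_finite_All)
      fix j assume "j \<in> {..<N}"
      hence "(\<lambda>z. z j) -` cyl R \<inter> space (base_measure N) \<in> sets (base_measure N)"
        using cyl by (intro measurable_sets[where A = borel] borel_closed) auto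
      thus "{z \<in> space (base_measure N). z j \<in> cyl R} \<in> sets (base_measure N)"
        by (simp add: vimage_def Int_def conj_commute)
    qed simp
    thus ?thesis by (simp only: Ball_def lessThan_iff)
  qed
  have [measurable]: "(\<lambda>z. \<Prod>k<N. \<Prod>j<k. (exp (z k / of_real R) - exp (z j / of_real R)) ^ p) \<in> borel_measurable (base_measure N)"
    by (intro borel_measurable_prod borel_measurable_power borel_measurable_diff borel_measurable_exp borel_measurable_divide) auto
  have [measurable]: "(\<lambda>z. \<Sum>k<N. (Re (z k))\<^sup>2) \<in> borel_measurable (base_measure N)"
    by (intro borel_measurable_sum borel_measurable_power measurable_Re_component) auto
  show ?thesis
    unfolding laughlin_sq_def using 1 by measurable
qed

text \<open>Here \<open>g i\<close> is the label of the particle of rank \<open>i\<close>. The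
  hypotheses on \<tau> make the pushed configuration stay in the region: strict inequalities
  persist, and where two equal positions stay equal, the index still breaks the tie. Integrating the
  pointwise bound and changing variables gives mass of the same region on the right.\<close>

lemma transport_estimate:
  assumes g: "g permutes {..<N}"
    and par: "R > 0" "l > 0" "a = real p * l\<^sup>2 / R"
    and tr: "\<And>i. i < N \<Longrightarrow> transports (\<tau> i) (J i)"
    and ord: "\<And>i j x y. i < j \<Longrightarrow> j < N \<Longrightarrow> x < y \<Longrightarrow> \<tau> i x < \<tau> j y"
      "\<And>i j x. i < j \<Longrightarrow> j < N \<Longrightarrow> \<tau> i x \<le> \<tau> j x"
    and E: "E \<subseteq> sorted_region N g" "E \<in> sets (base_measure N)" and \<epsilon>: "0 \<le> \<epsilon>"
    and est: "\<And>z. z \<in> E \<Longrightarrow> sorted_weight a l R p N (z \<circ> g) \<le>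
      \<epsilon> * (sorted_weight a l R p N (move \<tau> (z \<circ> g)) * (\<Prod>i<N. J i (Re (z (g i)))))"
  shows "emeasure (laughlin_unnorm R l p N) E \<le> ennreal \<epsilon> * emeasure (laughlin_unnorm R l p N) (sorted_region N g)"
proof -
  let ?M = "base_measure N"
  let ?W = "laughlin_sq R l p N"
  \<comment> \<open>Coordinates are labelled by particles while \<tau> is labelled by ranks; on the
    region, particle \<open>k\<close> has rank \<open>inv g k\<close>.\<close>
  define \<tau>' where "\<tau>' k z = Complex (\<tau> (inv g k) (Re z)) (Im z)" for k z
  define J' where "J' k z = J (inv g k) (Re z)" for k and z :: complex
  define F where "F z = (\<lambda>k\<in>{..<N}. \<tau>' k (z k))" for z
  define h where "h z = ennreal (?W z) * indicator (sorted_region N g) z" for z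
  have ig: "inv g (g i) = i" "g (inv g i) = i" for i using permutes_inverses[OF g] by auto
  have gN: "g i < N \<longleftrightarrow> i < N" for i using permutes_in_image[OF g, of i] by auto
  have igN: "inv g i < N \<longleftrightarrow> i < N" for i using permutes_in_image[OF permutes_inv[OF g], of i] by auto
  have tr': "transports (\<tau>' k) (J' k)" if "k \<in> {..<N}" for k
    unfolding \<tau>'_def J'_def using tr[of "inv g k"] that igN by (intro transports_complex) auto
  have Jnn: "0 \<le> J i x" if "i < N" for i x using tr[OF that] by (simp add: transports_def)
  have W0: "0 \<le> ?W z" for z by (simp add: laughlin_sq_def)
  have hm: "h \<in> borel_measurable ?M" unfolding h_def using sets_sorted_region[OF g] by measurable
  have pt: "ennreal (?W z) * indicator E z \<le> ennreal \<epsilon> * (ennreal (\<Prod>k<N. J' k (z k)) * h (F z))" for z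
  proof (cases "z \<in> E \<and> (\<forall>j<N. z j \<in> cyl R)")
    case True
    hence zE: "z \<in> E" and zc: "\<forall>j<N. z j \<in> cyl R" by auto
    have Fg: "F z (g i) = move \<tau> (z \<circ> g) i" if "i < N" for i
      using that by (simp add: F_def \<tau>'_def move_def ig gN)
    have "F z k = \<tau>' k (z k)" if "k < N" for k using that by (simp add: F_def)
    hence Fc: "\<forall>j<N. F z j \<in> cyl R" using zc by (simp add: cyl_def \<tau>'_def)
    have gz: "\<forall>j<N. (z \<circ> g) j \<in> cyl R" "\<forall>j<N. (F z \<circ> g) j \<in> cyl R" using zc Fc gN by auto
    have FS: "F z \<in> sorted_region N g"
    proof -
      have sp: "F z \<in> space ?M" by (auto simp: base_measure_def space_PiM F_def)
      have "lex_less (\<lambda>k. Re (F z k)) (g i) (g j)" if ij: "i < j" "j < N" for i j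
      proof -
        have "lex_less (\<lambda>k. Re (z k)) (g i) (g j)" using zE E(1) ij by (auto simp: sorted_region_def)
        thus ?thesis
          using ord(1)[OF ij, of "Re (z (g i))" "Re (z (g j))"] ord(2)[OF ij, of "Re (z (g i))"] ij
          by (auto simp: lex_less_def Fg move_def)
      qed
      thus ?thesis using sp by (auto simp: sorted_region_def)
    qed
    define A where "A = exp ((\<Sum>i<N. (a * real i)\<^sup>2) / l\<^sup>2)"
    have "?W z = A * sorted_weight a l R p N (z \<circ> g)"
      unfolding A_def using laughlin_sq_permute[OF g] laughlin_sq_eq_sorted_weight[OF par gz(1)] by metis
    also have "\<dots> \<le> A * (\<epsilon> * (sorted_weight a l R p N (move \<tau> (z \<circ> g)) * (\<Prod>i<N. J i (Re (z (g i))))))"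
      using est[OF zE] by (intro mult_left_mono) (auto simp: A_def)
    also have "sorted_weight a l R p N (move \<tau> (z \<circ> g)) = sorted_weight a l R p N (F z \<circ> g)"
      by (rule sorted_weight_cong) (simp add: Fg)
    also have "A * (\<epsilon> * (sorted_weight a l R p N (F z \<circ> g) * (\<Prod>i<N. J i (Re (z (g i)))))) =
        \<epsilon> * ((\<Prod>i<N. J i (Re (z (g i)))) * (A * sorted_weight a l R p N (F z \<circ> g)))" by simp
    also have "A * sorted_weight a l R p N (F z \<circ> g) = ?W (F z)"
      unfolding A_def using laughlin_sq_permute[OF g] laughlin_sq_eq_sorted_weight[OF par gz(2)] by metis
    also have "(\<Prod>i<N. J i (Re (z (g i)))) = (\<Prod>k<N. J' k (z k))"
      using prod.permute[OF g, of "\<lambda>k. J' k (z k)"] by (simp add: comp_def J'_def ig)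
    finally have "?W z \<le> \<epsilon> * ((\<Prod>k<N. J' k (z k)) * ?W (F z))" .
    moreover have "0 \<le> (\<Prod>k<N. J' k (z k))" using Jnn igN by (intro prod_nonneg) (auto simp: J'_def)
    ultimately have "ennreal (?W z) \<le> ennreal \<epsilon> * (ennreal (\<Prod>k<N. J' k (z k)) * ennreal (?W (F z)))"
      using \<epsilon> W0 by (simp flip: ennreal_mult ennreal_mult')
    thus ?thesis using FS zE by (simp add: h_def)
  next
    case False
    thus ?thesis by (auto simp: laughlin_sq_def)
  qed
  have Pm: "(\<lambda>z. ennreal (\<Prod>k<N. J' k (z k)) * h (F z)) \<in> borel_measurable ?M"
  proof -
    have mt: "\<tau>' k \<in> borel_measurable lborel" "J' k \<in> borel_measurable lborel" if "k \<in> {..<N}" for k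
      using tr'[OF that] by (simp_all add: transports_def)
    have "F \<in> measurable ?M ?M" unfolding F_def base_measure_def
      using mt(1) by (intro measurable_restrict measurable_compose[OF measurable_component_singleton]) auto
    moreover have "(\<lambda>z. \<Prod>k<N. J' k (z k)) \<in> borel_measurable ?M" unfolding base_measure_def
      using mt(2) by (intro borel_measurable_prod measurable_compose[OF measurable_component_singleton]) auto
    ultimately show ?thesis using hm by simp
  qed
  have "emeasure (laughlin_unnorm R l p N) E = (\<integral>\<^sup>+z. ennreal (?W z) * indicator E z \<partial>?M)"
    unfolding laughlin_unnorm_def using E(2) by (intro emeasure_density) auto
  also have "\<dots> \<le> (\<integral>\<^sup>+z. ennreal \<epsilon> * (ennreal (\<Prod>k<N. J' k (z k)) * h (F z)) \<partial>?M)"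
    by (intro nn_integral_mono pt)
  also have "\<dots> = ennreal \<epsilon> * (\<integral>\<^sup>+z. ennreal (\<Prod>k<N. J' k (z k)) * h (F z) \<partial>?M)"
    by (rule nn_integral_cmult[OF Pm])
  also have "(\<integral>\<^sup>+z. ennreal (\<Prod>k<N. J' k (z k)) * h (F z) \<partial>?M) = (\<integral>\<^sup>+z. h z \<partial>?M)"
    unfolding F_def base_measure_def
    by (rule nn_integral_PiM_transports) (use tr' hm in \<open>auto simp: base_measure_def\<close>)
  also have "\<dots> = emeasure (laughlin_unnorm R l p N) (sorted_region N g)"
    unfolding laughlin_unnorm_def h_def using sets_sorted_region[OF g] by (intro emeasure_density[symmetric]) auto
  finally show ?thesis .
qed

section \<open>Probability of one excursion\<close>

lemma transports_slide_from:
  assumes "h \<ge> 0"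
  shows "transports (slide_from b X h i) (slide_from_jac b X h i)"
proof (cases "b \<le> i")
  case True
  hence "slide_from b X h i = (\<lambda>x. x + slide X h x)" "slide_from_jac b X h i = slide_jac X h"
    by (auto simp: slide_from_def slide_from_jac_def)
  thus ?thesis using transports_slide[OF assms] by simp
next
  case False
  hence "slide_from b X h i = (\<lambda>x. x)" "slide_from_jac b X h i = (\<lambda>_. 1)"
    by (auto simp: slide_from_def slide_from_jac_def)
  thus ?thesis using transports_id by simp
qed

lemma slide_from_less:
  assumes "h \<ge> 0" "i \<le> j" "x < y"
  shows "slide_from b X h i x < slide_from b X h j y"
  using assms slide_contract[of h x y X] slide_bounds[of h X y] by (auto simp: slide_from_def field_simps)

lemma slide_from_le:
  assumes "h \<ge> 0" "i \<le> j"
  shows "slide_from b X h i x \<le> slide_from b X h j x"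
  using assms slide_bounds[of h X x] by (auto simp: slide_from_def)

text \<open>The parameter \<phi> is the identity for leftward and \<open>reflect_config a N\<close>
  for rightward excursions; either way membership in the region concerns the original
  configuration.\<close>

definition excursion_region ::
  "((nat \<Rightarrow> complex) \<Rightarrow> nat \<Rightarrow> complex) \<Rightarrow> real \<Rightarrow> nat \<Rightarrow> nat \<Rightarrow> nat \<Rightarrow> nat \<Rightarrow> (nat \<Rightarrow> nat) \<Rightarrow> (nat \<Rightarrow> complex) set"
  where "excursion_region \<phi> a N n r q g =
    {z \<in> sorted_region N g. excursion a N n (\<lambda>i. a * real i - Re (\<phi> (z \<circ> g) i)) r q}"

lemma sets_excursion:
  assumes "S \<in> sets M" and m: "\<And>i. i < N \<Longrightarrow> (\<lambda>z. \<delta> z i) \<in> borel_measurable M"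
  shows "{z \<in> S. excursion a N n (\<delta> z) r q} \<in> sets M"
proof (cases "r < N")
  case True
  have "{z \<in> S. excursion a N n (\<delta> z) r q} = S \<inter> {z \<in> space M. n \<le> r \<and> real q * a \<le> \<delta> z r \<and> \<delta> z r \<le> (real q + 1) * a \<and>
     (\<forall>i\<in>{r<..<N}. \<delta> z i \<le> 3 * (real q + 1) * a + a / 4 * (real i - real r)) \<and>
     (\<forall>i\<in>{..<r}. - \<delta> z i \<le> 3 * (real q + 1) * a + a / 4 * (real r - real i))}"
    using sets.sets_into_space[OF assms(1)] True by (auto simp: excursion_def)
  also have "\<dots> \<in> sets M"
    using True by (intro sets.Int assms(1) sets.sets_Collect_conj sets.sets_Collect_finite_All sets.sets_Collect_const
        borel_measurable_le borel_measurable_const borel_measurable_uminus m finite_lessThan finite_greaterThanLessThan) auto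
  finally show ?thesis .
next
  case False
  hence "{z \<in> S. excursion a N n (\<delta> z) r q} = {}" by (auto simp: excursion_def)
  thus ?thesis by (simp only: sets.empty_sets)
qed

lemma sets_excursion_region:
  assumes g: "g permutes {..<N}" and \<phi>: "\<phi> = (\<lambda>u. u) \<or> \<phi> = reflect_config a N"
  shows "excursion_region \<phi> a N n r q g \<in> sets (base_measure N)"
  unfolding excursion_region_def
proof (rule sets_excursion[OF sets_sorted_region[OF g]])
  fix i assume i: "i < N"
  have gN: "g i < N" if "i < N" for i using permutes_in_image[OF g] that by auto
  have m: "(\<lambda>z. Re (z (g j))) \<in> borel_measurable (base_measure N)" if "j < N" for j
    using gN[OF that] by (rule measurable_Re_component)
  show "(\<lambda>z. a * real i - Re (\<phi> (z \<circ> g) i)) \<in> borel_measurable (base_measure N)"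
    using \<phi> m[OF i] m[of "N - 1 - i"] i by (auto simp: reflect_config_def)
qed

definition gain_factor :: "real \<Rightarrow> real \<Rightarrow> real \<Rightarrow> nat \<Rightarrow> nat \<Rightarrow> nat \<Rightarrow> real" where
  "gain_factor a l R p n q =
    exp (- ((real q)\<^sup>2 * (3 * a\<^sup>2 * real (n div 2) / (32 * l\<^sup>2) - (128 * real p * crowd_const a R * a + 8))))"

lemma sorted_region_le:
  assumes "z \<in> sorted_region N g" "i \<le> j" "j < N"
  shows "Re (z (g i)) \<le> Re (z (g j))"
  using assms by (cases "i = j") (auto simp: sorted_region_def lex_less_def order_le_less)

text \<open>A rightward excursion is a leftward one of the reflected configuration. Only the
  invariant weight is reflected; the map applied to z itself is the slide conjugated by x -> C - x
  with ranks reversed.\<close>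

lemma excursion_region_bound:
  assumes g: "g permutes {..<N}" and \<phi>: "\<phi> = (\<lambda>u. u) \<or> \<phi> = reflect_config a N"
    and par: "R > 0" "l > 0" "a = real p * l\<^sup>2 / R" "p \<ge> 1"
    and q: "1 \<le> q" "n \<le> q + 1"
    and big: "2 * real p * crowd_const a R \<le> 3 * real q * a / (16 * l\<^sup>2)"
  shows "emeasure (laughlin_unnorm R l p N) (excursion_region \<phi> a N n r q g) \<le>
    ennreal (gain_factor a l R p n q) * emeasure (laughlin_unnorm R l p N) (sorted_region N g)"
proof -
  define X where "X = a * real r - real q * a"
  define h where "h = real q * a / 4"
  define b where "b = r + 1 - n div 2"
  define \<tau> where "\<tau> = slide_from b X h"
  define J where "J = slide_from_jac b X h"
  have a: "a > 0" using par by simp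
  have h: "h \<ge> 0" using a by (simp add: h_def)
  have sub: "excursion_region \<phi> a N n r q g \<subseteq> sorted_region N g" by (auto simp: excursion_region_def)
  have gain0: "0 \<le> gain_factor a l R p n q" by (simp add: gain_factor_def)
  note slide = sorted_weight_slide[OF a par(2,1) _ _ q big refl X_def h_def b_def, folded gain_factor_def \<tau>_def J_def]
  from \<phi> show ?thesis
  proof
    assume \<phi>: "\<phi> = (\<lambda>u. u)"
    show ?thesis
    proof (rule transport_estimate[OF g par(1-3) _ _ _ sub sets_excursion_region[OF g] gain0, where \<tau> = \<tau> and J = J])
      fix z assume z: "z \<in> excursion_region \<phi> a N n r q g"
      show "sorted_weight a l R p N (z \<circ> g) \<le> gain_factor a l R p n q *
          (sorted_weight a l R p N (move \<tau> (z \<circ> g)) * (\<Prod>i<N. J i (Re (z (g i)))))"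
        using slide[of N "z \<circ> g"] z sub sorted_region_le[of z N g] by (auto simp: excursion_region_def \<phi>)
    next
      show "transports (\<tau> i) (J i)" for i unfolding \<tau>_def J_def by (rule transports_slide_from[OF h])
      show "\<tau> i x < \<tau> j y" if "i < j" "x < y" for i j x y
        unfolding \<tau>_def using that by (intro slide_from_less[OF h]) auto
      show "\<tau> i x \<le> \<tau> j x" if "i < j" for i j x
        unfolding \<tau>_def using that by (intro slide_from_le[OF h]) auto
    qed (rule \<open>\<phi> = (\<lambda>u. u) \<or> \<phi> = reflect_config a N\<close>)
  next
    assume \<phi>: "\<phi> = reflect_config a N"
    define C where "C = a * (real N - 1)"
    show ?thesis
    proof (rule transport_estimate[OF g par(1-3) _ _ _ sub sets_excursion_region[OF g] gain0,
          where \<tau> = "\<lambda>i x. C - \<tau> (N - 1 - i) (C - x)" and J = "\<lambda>i x. J (N - 1 - i) (C - x)"])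
      fix z assume z: "z \<in> excursion_region \<phi> a N n r q g"
      define u where "u = z \<circ> g"
      have le: "Re (reflect_config a N u i) \<le> Re (reflect_config a N u j)" if "i \<le> j" "j < N" for i j
        using sorted_region_le[of z N g "N - 1 - j" "N - 1 - i"] z sub that by (auto simp: reflect_config_def u_def)
      have "sorted_weight a l R p N u = sorted_weight a l R p N (reflect_config a N u)"
        by (rule sorted_weight_reflect[symmetric])
      also have "\<dots> \<le> gain_factor a l R p n q *
          (sorted_weight a l R p N (move \<tau> (reflect_config a N u)) * (\<Prod>i<N. J i (Re (reflect_config a N u i))))"
        using slide[OF le] z by (auto simp: excursion_region_def \<phi> u_def)
      also have "sorted_weight a l R p N (move \<tau> (reflect_config a N u)) =
          sorted_weight a l R p N (reflect_config a N (move \<tau> (reflect_config a N u)))"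
        by (rule sorted_weight_reflect[symmetric])
      also have "\<dots> = sorted_weight a l R p N (move (\<lambda>i x. C - \<tau> (N - 1 - i) (C - x)) u)"
        by (rule sorted_weight_cong) (auto simp: reflect_config_def move_def C_def complex_eq_iff)
      also have "(\<Prod>i<N. J i (Re (reflect_config a N u i))) = (\<Prod>i<N. J (N - 1 - i) (C - Re (u i)))"
        by (rule prod.reindex_bij_witness[of _ "\<lambda>i. N - 1 - i" "\<lambda>i. N - 1 - i"]) (auto simp: reflect_config_def C_def)
      finally show "sorted_weight a l R p N (z \<circ> g) \<le> gain_factor a l R p n q *
          (sorted_weight a l R p N (move (\<lambda>i x. C - \<tau> (N - 1 - i) (C - x)) (z \<circ> g)) *
           (\<Prod>i<N. J (N - 1 - i) (C - Re (z (g i)))))"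
        unfolding u_def comp_def .
    next
      show "transports (\<lambda>x. C - \<tau> (N - 1 - i) (C - x)) (\<lambda>x. J (N - 1 - i) (C - x))" for i
        unfolding \<tau>_def J_def by (intro transports_reflect transports_slide_from[OF h])
      show "C - \<tau> (N - 1 - i) (C - x) < C - \<tau> (N - 1 - j) (C - y)" if "i < j" "x < y" for i j x y
        using slide_from_less[OF h, of "N - 1 - j" "N - 1 - i" "C - y" "C - x" b X] that unfolding \<tau>_def by auto
      show "C - \<tau> (N - 1 - i) (C - x) \<le> C - \<tau> (N - 1 - j) (C - x)" if "i < j" for i j x
        using slide_from_le[OF h, of "N - 1 - j" "N - 1 - i" b X "C - x"] that unfolding \<tau>_def by auto
    qed (rule \<open>\<phi> = (\<lambda>u. u) \<or> \<phi> = reflect_config a N\<close>)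
  qed
qed

text \<open>Uniqueness of the sorting makes the regions disjoint, so summing the regional bounds
  over all permutations costs nothing.\<close>

lemma sum_sorted_regions_le:
  "(\<Sum>g | g permutes {..<N}. emeasure (laughlin_unnorm R l p N) (sorted_region N g)) \<le>
    emeasure (laughlin_unnorm R l p N) (space (base_measure N))"
proof -
  let ?\<mu> = "laughlin_unnorm R l p N"
  have [simp]: "sets ?\<mu> = sets (base_measure N)" "space ?\<mu> = space (base_measure N)"
    by (simp_all add: laughlin_unnorm_def)
  have "(\<Sum>g | g permutes {..<N}. emeasure ?\<mu> (sorted_region N g)) = emeasure ?\<mu> (\<Union>g\<in>{g. g permutes {..<N}}. sorted_region N g)"
  proof (rule sum_emeasure)
    show "disjoint_family_on (sorted_region N) {g. g permutes {..<N}}"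
    proof (unfold disjoint_family_on_def, intro ballI impI equals0I)
      fix g g' z assume g: "g \<in> {g. g permutes {..<N}}" "g' \<in> {g. g permutes {..<N}}" "g \<noteq> g'"
        and z: "z \<in> sorted_region N g \<inter> sorted_region N g'"
      have "g = g'"
        by (rule lex_sorting_unique[where N = N and x = "\<lambda>k. Re (z k)"]) (use g z in \<open>auto simp: sorted_region_def\<close>)
      thus False using g by simp
    qed
  qed (auto simp: sets_sorted_region finite_permutations)
  also have "\<dots> \<le> emeasure ?\<mu> (space ?\<mu>)" by (rule emeasure_space)
  finally show ?thesis by simp
qed

lemma excursion_union_bound:
  assumes \<phi>: "\<phi> = (\<lambda>u. u) \<or> \<phi> = reflect_config a N"
    and par: "R > 0" "l > 0" "a = real p * l\<^sup>2 / R" "p \<ge> 1"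
    and q: "1 \<le> q" "n \<le> q + 1"
    and big: "2 * real p * crowd_const a R \<le> 3 * real q * a / (16 * l\<^sup>2)"
  shows "emeasure (laughlin_unnorm R l p N) (\<Union>g\<in>{g. g permutes {..<N}}. excursion_region \<phi> a N n r q g) \<le>
    ennreal (gain_factor a l R p n q) * emeasure (laughlin_unnorm R l p N) (space (base_measure N))"
proof -
  let ?\<mu> = "laughlin_unnorm R l p N"
  have "emeasure ?\<mu> (\<Union>g\<in>{g. g permutes {..<N}}. excursion_region \<phi> a N n r q g) \<le>
      (\<Sum>g | g permutes {..<N}. emeasure ?\<mu> (excursion_region \<phi> a N n r q g))"
    using sets_excursion_region[OF _ \<phi>]
    by (intro emeasure_subadditive_finite) (auto simp: finite_permutations laughlin_unnorm_def)
  also have "\<dots> \<le> (\<Sum>g | g permutes {..<N}. ennreal (gain_factor a l R p n q) * emeasure ?\<mu> (sorted_region N g))"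
    by (intro sum_mono excursion_region_bound[OF _ \<phi> par q big]) auto
  also have "\<dots> \<le> ennreal (gain_factor a l R p n q) * emeasure ?\<mu> (space (base_measure N))"
    unfolding sum_distrib_left[symmetric] by (intro mult_left_mono sum_sorted_regions_le) auto
  finally show ?thesis .
qed

section \<open>A large excess forces an excursion near the cut\<close>

lemma excursion_cong:
  assumes "\<And>i. i < N \<Longrightarrow> \<delta> i = \<delta>' i"
  shows "excursion a N n \<delta> r q \<longleftrightarrow> excursion a N n \<delta>' r q"
proof (cases "r < N")
  case True thus ?thesis unfolding excursion_def by (auto simp: assms)
qed (simp add: excursion_def)

definition excursions :: "real \<Rightarrow> nat \<Rightarrow> nat \<Rightarrow> nat \<Rightarrow> nat \<Rightarrow> (nat \<Rightarrow> complex) set" where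
  "excursions a N n r q =
     (\<Union>g\<in>{g. g permutes {..<N}}. excursion_region (\<lambda>u. u) a N n r q g) \<union>
     (\<Union>g\<in>{g. g permutes {..<N}}. excursion_region (reflect_config a N) a N n r q g)"

lemma displacement_cover:
  assumes a: "a > 0" and g: "g permutes {..<N}" and z: "z \<in> sorted_region N g"
    and n: "1 \<le> n" "n \<le> r0" "r0 < N"
    and start: "a * real r0 - Re (z (g r0)) \<ge> (real n - 1/2) * a"
  shows "\<exists>r q. r < N \<and> n \<le> q + 1 \<and> \<bar>real r - real r0\<bar> < 4 * (real q + 1) \<and>
    (z \<in> excursions a N n r q \<or> z \<in> excursions a N n (N - 1 - r) q)"
proof -
  define \<delta> where "\<delta> i = a * real i - Re (z (g i))" for i
  have slope: "\<delta> j - \<delta> i \<le> a * (real j - real i)" if "i \<le> j" "j < N" for i j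
    using sorted_region_le[OF z that] by (simp add: \<delta>_def algebra_simps)
  obtain r q where rq: "r < N" "n \<le> q + 1" "\<bar>real r - real r0\<bar> < 4 * (real q + 1)"
    and ex: "excursion a N n \<delta> r q \<or> excursion a N n (\<lambda>i. - \<delta> (N - 1 - i)) (N - 1 - r) q"
    using excursion_exists[OF a slope n] start unfolding \<delta>_def by blast
  have "excursion a N n (\<lambda>i. - \<delta> (N - 1 - i)) (N - 1 - r) q \<longleftrightarrow>
      excursion a N n (\<lambda>i. a * real i - Re (reflect_config a N (z \<circ> g) i)) (N - 1 - r) q"
    by (rule excursion_cong) (simp add: \<delta>_def reflect_config_def of_nat_diff algebra_simps)
  moreover have "\<delta> = (\<lambda>i. a * real i - Re ((z \<circ> g) i))" by (simp add: \<delta>_def fun_eq_iff)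
  ultimately have "z \<in> excursion_region (\<lambda>u. u) a N n r q g \<or> z \<in> excursion_region (reflect_config a N) a N n (N - 1 - r) q g"
    using ex z unfolding excursion_region_def by simp
  hence "z \<in> excursions a N n r q \<or> z \<in> excursions a N n (N - 1 - r) q"
    using g by (auto simp: excursions_def)
  thus ?thesis using rq by blast
qed

text \<open>The search for an extremal rank is run on the displacements read from the right end with
  opposite sign. Its two outcomes then swap roles: the direct one lies in a reflected region and
  conversely.\<close>

lemma displacement_cover_reflect:
  assumes a: "a > 0" and g: "g permutes {..<N}" and z: "z \<in> sorted_region N g"
    and n: "1 \<le> n" "n + r0 \<le> N - 1" "r0 < N"
    and start: "a * real r0 - Re (z (g r0)) \<le> - ((real n - 1/2) * a)"
  shows "\<exists>r q. r < N \<and> n \<le> q + 1 \<and> \<bar>real r - real (N - 1 - r0)\<bar> < 4 * (real q + 1) \<and>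
    (z \<in> excursions a N n r q \<or> z \<in> excursions a N n (N - 1 - r) q)"
proof -
  define \<delta> where "\<delta> i = - (a * real (N - 1 - i) - Re (z (g (N - 1 - i))))" for i
  have slope: "\<delta> j - \<delta> i \<le> a * (real j - real i)" if "i \<le> j" "j < N" for i j
    using sorted_region_le[OF z, of "N - 1 - j" "N - 1 - i"] that by (simp add: \<delta>_def of_nat_diff algebra_simps)
  have n': "1 \<le> n" "n \<le> N - 1 - r0" "N - 1 - r0 < N" using n by auto
  have "N - 1 - (N - 1 - r0) = r0" using n by simp
  hence "(real n - 1/2) * a \<le> \<delta> (N - 1 - r0)" using start by (simp add: \<delta>_def)
  from excursion_exists[OF a slope n' this]
  obtain r q where rq: "r < N" "n \<le> q + 1" "\<bar>real r - real (N - 1 - r0)\<bar> < 4 * (real q + 1)"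
    and ex: "excursion a N n \<delta> r q \<or> excursion a N n (\<lambda>i. - \<delta> (N - 1 - i)) (N - 1 - r) q"
    by blast
  have "excursion a N n \<delta> r q \<longleftrightarrow> excursion a N n (\<lambda>i. a * real i - Re (reflect_config a N (z \<circ> g) i)) r q"
    by (rule excursion_cong) (simp add: \<delta>_def reflect_config_def of_nat_diff algebra_simps)
  moreover have "excursion a N n (\<lambda>i. - \<delta> (N - 1 - i)) (N - 1 - r) q \<longleftrightarrow>
      excursion a N n (\<lambda>i. a * real i - Re ((z \<circ> g) i)) (N - 1 - r) q"
    by (rule excursion_cong) (simp add: \<delta>_def)
  ultimately have "z \<in> excursion_region (reflect_config a N) a N n r q g \<or> z \<in> excursion_region (\<lambda>u. u) a N n (N - 1 - r) q g"
    using ex z unfolding excursion_region_def by blast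
  hence "z \<in> excursions a N n r q \<or> z \<in> excursions a N n (N - 1 - r) q"
    using g by (auto simp: excursions_def)
  thus ?thesis using rq by blast
qed

definition near :: "nat \<Rightarrow> nat \<Rightarrow> nat set" where
  "near r0 q = {r. \<bar>real r - real r0\<bar> < 4 * (real q + 1)}"

lemma near_finite_card: "finite (near r0 q)" "card (near r0 q) \<le> 8 * q + 9"
proof -
  have sub: "near r0 q \<subseteq> {r0 - 4 * (q + 1)..r0 + 4 * (q + 1)}"
  proof
    fix r assume "r \<in> near r0 q"
    hence "real r < real (r0 + 4 * (q + 1))" "real r0 < real (r + 4 * (q + 1))" by (auto simp: near_def)
    hence "r < r0 + 4 * (q + 1)" "r0 < r + 4 * (q + 1)" by (simp_all only: of_nat_less_iff)
    thus "r \<in> {r0 - 4 * (q + 1)..r0 + 4 * (q + 1)}" by auto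
  qed
  show "finite (near r0 q)" by (rule finite_subset[OF sub]) simp
  have "card (near r0 q) \<le> card {r0 - 4 * (q + 1)..r0 + 4 * (q + 1)}" by (rule card_mono[OF _ sub]) simp
  also have "\<dots> \<le> 8 * q + 9" by simp
  finally show "card (near r0 q) \<le> 8 * q + 9" .
qed

text \<open>The cut lies midway between the sites of ranks k - 1 and k, counted from 0. An excess of
  \<open>n\<close> puts rank k + n - 1 left of it, a deficit of \<open>n\<close> puts rank k - n
  right of it, and both are then off by at least (n - 1/2) a. The bounds on \<open>k\<close> leave
  \<open>n\<close> ranks between the displaced one and the end of the system in question.\<close>

lemma particle_excess_cover:
  assumes a: "a > 0" and z: "z \<in> space (base_measure N)" and k: "1 \<le> k" "k \<le> N - 1" and n: "1 \<le> n"
    and bad: "\<bar>particle_excess N k ((real k - 1/2) * a) z\<bar> \<ge> int n"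
  shows "\<exists>q. n \<le> q + 1 \<and> (\<exists>r \<in> near (k + n - 1) q \<union> near (N - 1 - (k - n)) q.
    z \<in> excursions a N n r q \<or> z \<in> excursions a N n (N - 1 - r) q)"
proof -
  obtain g where g: "g permutes {..<N}" and "\<forall>i j. i < j \<longrightarrow> j < N \<longrightarrow> lex_less (\<lambda>k. Re (z k)) (g i) (g j)"
    using ex_lex_sorting by blast
  hence zg: "z \<in> sorted_region N g" using z by (auto simp: sorted_region_def)
  let ?x = "(real k - 1/2) * a"
  define A where "A = {i. i < N \<and> Re (z (g i)) \<le> ?x}"
  have "{j. j < N \<and> Re (z j) \<le> ?x} = g ` A"
  proof (intro equalityI subsetI)
    fix j assume j: "j \<in> {j. j < N \<and> Re (z j) \<le> ?x}"
    then obtain i where "j = g i" "i < N"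
      using permutes_surj[OF g] permutes_in_image[OF g] by (metis lessThan_iff mem_Collect_eq surjD)
    thus "j \<in> g ` A" using j by (auto simp: A_def)
  qed (use permutes_in_image[OF g] in \<open>auto simp: A_def\<close>)
  hence cnt: "particle_excess N k ?x z = int (card A) - int k"
    using permutes_inj_on[OF g, of A] by (simp add: particle_excess_def card_image)
  have finA: "finite A" by (auto simp: A_def)
  from bad cnt consider "card A \<ge> k + n" | "card A + n \<le> k" by linarith
  thus ?thesis
  proof cases
    case 1
    have "card A \<le> card {..<N}" by (rule card_mono) (auto simp: A_def)
    hence rN: "k + n - 1 < N" using 1 k by simp
    have "k + n - 1 \<in> A"
    proof (rule ccontr)
      assume "k + n - 1 \<notin> A"
      hence "i < k + n - 1" if "i \<in> A" for i
        using that sorted_region_le[OF zg, of "k + n - 1" i] rN unfolding A_def by force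
      hence "card A \<le> card {..<k + n - 1}" by (intro card_mono) auto
      thus False using 1 k by simp
    qed
    hence "Re (z (g (k + n - 1))) \<le> ?x" by (simp add: A_def)
    moreover have "a * real (k + n - 1) - ?x = (real n - 1/2) * a"
      using k by (simp add: of_nat_diff algebra_simps)
    ultimately have "(real n - 1/2) * a \<le> a * real (k + n - 1) - Re (z (g (k + n - 1)))" by linarith
    moreover have "n \<le> k + n - 1" using k by linarith
    ultimately obtain r q where rq: "n \<le> q + 1" "\<bar>real r - real (k + n - 1)\<bar> < 4 * (real q + 1)"
      "z \<in> excursions a N n r q \<or> z \<in> excursions a N n (N - 1 - r) q"
      using displacement_cover[OF a g zg n _ rN] by blast
    from rq(2) have "r \<in> near (k + n - 1) q \<union> near (N - 1 - (k - n)) q" unfolding near_def by blast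
    thus ?thesis using rq(1,3) by blast
  next
    case 2
    have rN: "k - n < N" using k by simp
    have "k - n \<notin> A"
    proof
      assume *: "k - n \<in> A"
      have "i \<in> A" if "i \<le> k - n" for i
        using that sorted_region_le[OF zg that rN] * rN by (auto simp: A_def)
      hence "card {..k - n} \<le> card A" by (intro card_mono finA) auto
      thus False using 2 by simp
    qed
    hence "Re (z (g (k - n))) > ?x" using rN by (simp add: A_def)
    moreover have "a * real (k - n) - ?x = - ((real n - 1/2) * a)"
      using 2 by (simp add: of_nat_diff algebra_simps)
    ultimately have "a * real (k - n) - Re (z (g (k - n))) \<le> - ((real n - 1/2) * a)" by linarith
    moreover have "n + (k - n) \<le> N - 1" using 2 k by linarith
    ultimately obtain r q where rq: "n \<le> q + 1" "\<bar>real r - real (N - 1 - (k - n))\<bar> < 4 * (real q + 1)"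
      "z \<in> excursions a N n r q \<or> z \<in> excursions a N n (N - 1 - r) q"
      using displacement_cover_reflect[OF a g zg n _ rN] by blast
    from rq(2) have "r \<in> near (k + n - 1) q \<union> near (N - 1 - (k - n)) q" unfolding near_def by blast
    thus ?thesis using rq(1,3) by blast
  qed
qed

section \<open>The tail bound\<close>

text \<open>Let y = c n q^2. Since c n >= 2, half of y dominates q and so the polynomial prefactor.
  With q = n - 1 + t and (n - 1)^2 >= (n / 2)^2 the other half is at least (c / 8) n^3 + t, which
  leaves a geometric series in t.\<close>

lemma gain_factor_sum:
  fixes c :: real
  assumes c: "c > 0" and n: "2 \<le> n" "2 / c \<le> real n"
    and G: "\<And>q. n \<le> q + 1 \<Longrightarrow> G q \<le> exp (- (c * real n * (real q)\<^sup>2))"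
  shows "(\<Sum>t. ennreal (real (8 * (8 * (n - 1 + t) + 9)) * G (n - 1 + t))) \<le> ennreal (272 * exp (- (c / 8) * real n ^ 3))"
proof -
  define B where "B = 136 * exp (- (c / 8) * real n ^ 3)"
  have cn: "2 \<le> c * real n" using n c by (simp add: field_simps)
  have summand: "real (8 * (8 * q + 9)) * G q \<le> B * exp (- 1) ^ t" if q: "q = n - 1 + t" for q t
  proof -
    have q1: "1 \<le> q" "n \<le> q + 1" using n q by auto
    \<comment> \<open>136 = 64 + 72 dominates both coefficients; the geometric series of ratio 1/2
      later doubles it to 272.\<close>
    have "real (8 * (8 * q + 9)) \<le> 136 * (1 + real q)" by simp
    also have "\<dots> \<le> 136 * exp (real q)" by (intro mult_left_mono exp_ge_add_one_self) simp
    finally have "real (8 * (8 * q + 9)) * G q \<le> 136 * exp (real q) * exp (- (c * real n * (real q)\<^sup>2))"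
      using G[OF q1(2)] by (intro order_trans[OF mult_left_mono mult_right_mono]) auto
    also have "\<dots> = 136 * exp (real q - c * real n * (real q)\<^sup>2)" by (simp add: exp_diff exp_minus divide_inverse)
    also have "real q - c * real n * (real q)\<^sup>2 \<le> - (c / 8) * real n ^ 3 - real t"
    proof -
      define y where "y = c * real n * (real q)\<^sup>2"
      have "2 * (real q * real q) \<le> c * real n * (real q)\<^sup>2"
        unfolding power2_eq_square by (intro mult_right_mono cn) auto
      moreover have "real q * 1 \<le> real q * real q" using q1 by (intro mult_left_mono) auto
      ultimately have 1: "real q \<le> y / 2" unfolding y_def by linarith
      have qr: "real q = (real n - 1) + real t" using q n by (simp add: of_nat_diff)
      have tt: "real t \<le> (real t)\<^sup>2" by (cases t) (auto simp: power2_eq_square algebra_simps)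
      have "0 \<le> (real n - 1) * real t" using n by simp
      hence "(real n - 1)\<^sup>2 + real t \<le> (real q)\<^sup>2" unfolding qr using tt by (simp add: power2_eq_square algebra_simps)
      moreover have "(real n / 2)\<^sup>2 \<le> (real n - 1)\<^sup>2" using n by (intro power_mono) auto
      ultimately have "(real n)\<^sup>2 / 4 + real t \<le> (real q)\<^sup>2" by (simp add: power_divide)
      hence "c * real n * ((real n)\<^sup>2 / 4 + real t) \<le> y" unfolding y_def using c by (intro mult_left_mono) auto
      hence "c / 4 * real n ^ 3 + c * real n * real t \<le> y" by (simp add: power2_eq_square power3_eq_cube algebra_simps)
      moreover have "2 * real t \<le> c * real n * real t" by (intro mult_right_mono cn) auto
      ultimately have 2: "c / 4 * real n ^ 3 + 2 * real t \<le> y" by linarith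
      have "real q - y \<le> - (c / 8) * real n ^ 3 - real t" using 1 2 by linarith
      thus ?thesis unfolding y_def .
    qed
    also have "136 * exp (- (c / 8) * real n ^ 3 - real t) = B * exp (- 1) ^ t"
    proof -
      have "exp (- 1) ^ t = exp (- real t)" by (simp flip: exp_of_nat_mult)
      thus ?thesis by (simp only: B_def mult.assoc exp_add[symmetric]) simp
    qed
    finally show ?thesis by simp
  qed
  have half: "exp (- 1) \<le> (1 / 2 :: real)"
    using exp_ge_add_one_self[of "1::real"] by (simp add: exp_minus field_simps)
  have "(\<Sum>t. ennreal (real (8 * (8 * (n - 1 + t) + 9)) * G (n - 1 + t))) \<le> (\<Sum>t. ennreal (B * (1 / 2) ^ t))"
  proof (intro suminf_le ennreal_leI summableI)
    fix t
    have "B * exp (- 1) ^ t \<le> B * (1 / 2) ^ t" using half by (intro mult_left_mono power_mono) (auto simp: B_def)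
    thus "real (8 * (8 * (n - 1 + t) + 9)) * G (n - 1 + t) \<le> B * (1 / 2) ^ t" using summand[OF refl, of t] by linarith
  qed
  also have "\<dots> = ennreal (\<Sum>t. B * (1 / 2) ^ t)"
    by (intro suminf_ennreal2 summable_mult summable_geometric) (auto simp: B_def)
  also have "(\<Sum>t. B * (1 / 2) ^ t) = 272 * exp (- (c / 8) * real n ^ 3)"
    by (subst suminf_mult) (auto simp: suminf_geometric B_def intro: summable_geometric)
  finally show ?thesis .
qed

lemma excursions_bound:
  assumes par: "R > 0" "l > 0" "a = real p * l\<^sup>2 / R" "p \<ge> 1"
    and q: "1 \<le> q" "n \<le> q + 1"
    and big: "2 * real p * crowd_const a R \<le> 3 * real q * a / (16 * l\<^sup>2)"
  shows "excursions a N n r q \<in> sets (base_measure N)"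
    and "emeasure (laughlin_unnorm R l p N) (excursions a N n r q) \<le>
      ennreal (2 * gain_factor a l R p n q) * emeasure (laughlin_unnorm R l p N) (space (base_measure N))"
proof -
  let ?\<mu> = "laughlin_unnorm R l p N"
  let ?U = "\<lambda>\<phi>. \<Union>g\<in>{g. g permutes {..<N}}. excursion_region \<phi> a N n r q g"
  have G0: "0 \<le> gain_factor a l R p n q" by (simp add: gain_factor_def)
  have S: "?U (\<lambda>u. u) \<in> sets (base_measure N)" "?U (reflect_config a N) \<in> sets (base_measure N)"
    by (auto intro!: sets.finite_UN sets_excursion_region simp: finite_permutations)
  thus "excursions a N n r q \<in> sets (base_measure N)" unfolding excursions_def by blast
  have "emeasure ?\<mu> (excursions a N n r q) \<le> emeasure ?\<mu> (?U (\<lambda>u. u)) + emeasure ?\<mu> (?U (reflect_config a N))"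
    unfolding excursions_def using S by (intro emeasure_subadditive) (auto simp: laughlin_unnorm_def)
  also have "\<dots> \<le> ennreal (gain_factor a l R p n q) * emeasure ?\<mu> (space (base_measure N)) +
      ennreal (gain_factor a l R p n q) * emeasure ?\<mu> (space (base_measure N))"
    by (intro add_mono excursion_union_bound par q big) auto
  also have "\<dots> = ennreal (2 * gain_factor a l R p n q) * emeasure ?\<mu> (space (base_measure N))"
    using G0 by (simp only: distrib_right[symmetric] ennreal_plus[symmetric] mult_2)
  finally show "emeasure ?\<mu> (excursions a N n r q) \<le>
      ennreal (2 * gain_factor a l R p n q) * emeasure ?\<mu> (space (base_measure N))" .
qed

text \<open>Countable union bound over levels q >= n - 1. The factor 8 counts two centres (excess or
  deficit), the ranks r and N - 1 - r, and two directions.\<close>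

lemma particle_excess_emeasure:
  assumes par: "R > 0" "l > 0" "a = real p * l\<^sup>2 / R" "p \<ge> 1"
    and k: "1 \<le> k" "k \<le> N - 1" and n: "2 \<le> n"
    and big: "\<And>q. n \<le> q + 1 \<Longrightarrow> 2 * real p * crowd_const a R \<le> 3 * real q * a / (16 * l\<^sup>2)"
    and sm: "(\<Sum>t. ennreal (real (8 * (8 * (n - 1 + t) + 9)) * gain_factor a l R p n (n - 1 + t))) \<le> ennreal \<epsilon>"
  shows "emeasure (laughlin_unnorm R l p N)
      {z \<in> space (base_measure N). \<bar>particle_excess N k ((real k - 1/2) * a) z\<bar> \<ge> int n} \<le>
    ennreal \<epsilon> * emeasure (laughlin_unnorm R l p N) (space (base_measure N))"
proof -
  let ?\<mu> = "laughlin_unnorm R l p N"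
  let ?Z = "emeasure ?\<mu> (space (base_measure N))"
  have sets_\<mu>: "sets ?\<mu> = sets (base_measure N)" by (simp add: laughlin_unnorm_def)
  have a: "a > 0" using par by simp
  define V where "V q = near (k + n - 1) q \<union> near (N - 1 - (k - n)) q" for q
  define T where "T q = (\<Union>r\<in>V q. excursions a N n r q \<union> excursions a N n (N - 1 - r) q)" for q
  have finV: "finite (V q)" for q by (simp add: V_def near_finite_card)
  have cardV: "card (V q) \<le> 2 * (8 * q + 9)" for q
  proof -
    have "card (V q) \<le> card (near (k + n - 1) q) + card (near (N - 1 - (k - n)) q)"
      unfolding V_def by (rule card_Un_le)
    also have "\<dots> \<le> (8 * q + 9) + (8 * q + 9)" by (intro add_mono near_finite_card(2))
    finally show ?thesis by simp
  qed
  have T: "T q \<in> sets (base_measure N)"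
    "emeasure ?\<mu> (T q) \<le> ennreal (real (8 * (8 * q + 9)) * gain_factor a l R p n q) * ?Z" if q: "n \<le> q + 1" for q
  proof -
    let ?G = "gain_factor a l R p n q"
    have G0: "0 \<le> ?G" by (simp add: gain_factor_def)
    have q1: "1 \<le> q" using q n by simp
    note e = excursions_bound[OF par q1 q big[OF q]]
    show "T q \<in> sets (base_measure N)" unfolding T_def using finV e(1) by (intro sets.finite_UN) auto
    have "emeasure ?\<mu> (T q) \<le> (\<Sum>r\<in>V q. emeasure ?\<mu> (excursions a N n r q \<union> excursions a N n (N - 1 - r) q))"
      unfolding T_def using finV e(1) by (intro emeasure_subadditive_finite) (auto simp: sets_\<mu>)
    also have "\<dots> \<le> (\<Sum>r\<in>V q. ennreal (4 * ?G) * ?Z)"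
    proof (rule sum_mono)
      fix r
      have "emeasure ?\<mu> (excursions a N n r q \<union> excursions a N n (N - 1 - r) q) \<le>
          emeasure ?\<mu> (excursions a N n r q) + emeasure ?\<mu> (excursions a N n (N - 1 - r) q)"
        using e(1) by (intro emeasure_subadditive) (auto simp: sets_\<mu>)
      also have "\<dots> \<le> ennreal (2 * ?G) * ?Z + ennreal (2 * ?G) * ?Z" by (intro add_mono e(2))
      also have "\<dots> = ennreal (2 * ?G + 2 * ?G) * ?Z" 
        using G0 by (simp only: distrib_right[symmetric] ennreal_plus[symmetric] mult_nonneg_nonneg zero_le_numeral)
      finally show "emeasure ?\<mu> (excursions a N n r q \<union> excursions a N n (N - 1 - r) q) \<le> ennreal (4 * ?G) * ?Z" by simp
    qed
    also have "\<dots> = ennreal (real (card (V q)) * (4 * ?G)) * ?Z"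
      using G0 by (simp add: ennreal_mult ennreal_of_nat_eq_real_of_nat mult.assoc)
    also have "\<dots> \<le> ennreal (real (2 * (8 * q + 9)) * (4 * ?G)) * ?Z"
      using cardV[of q] G0 by (intro mult_right_mono ennreal_leI of_nat_mono) auto
    also have "real (2 * (8 * q + 9)) * (4 * ?G) = real (8 * (8 * q + 9)) * ?G" by simp
    finally show "emeasure ?\<mu> (T q) \<le> ennreal (real (8 * (8 * q + 9)) * ?G) * ?Z" .
  qed
  have Ts: "T (n - 1 + t) \<in> sets (base_measure N)" for t by (rule T(1)) simp
  have "{z \<in> space (base_measure N). \<bar>particle_excess N k ((real k - 1/2) * a) z\<bar> \<ge> int n} \<subseteq> (\<Union>t. T (n - 1 + t))"
  proof
    fix z assume "z \<in> {z \<in> space (base_measure N). \<bar>particle_excess N k ((real k - 1/2) * a) z\<bar> \<ge> int n}"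
    then obtain q where q: "n \<le> q + 1" "z \<in> T q"
      using particle_excess_cover[OF a _ k, of z n] n unfolding T_def V_def by auto
    have "q = n - 1 + (q - (n - 1))" using q by simp
    thus "z \<in> (\<Union>t. T (n - 1 + t))" using q(2) by (metis UN_I UNIV_I)
  qed
  hence "emeasure ?\<mu> {z \<in> space (base_measure N). \<bar>particle_excess N k ((real k - 1/2) * a) z\<bar> \<ge> int n} \<le>
      emeasure ?\<mu> (\<Union>t. T (n - 1 + t))"
    using Ts by (intro emeasure_mono) (auto simp: sets_\<mu>)
  also have "\<dots> \<le> (\<Sum>t. emeasure ?\<mu> (T (n - 1 + t)))"
    using Ts by (intro emeasure_subadditive_countably) (auto simp: sets_\<mu>)
  also have "\<dots> \<le> (\<Sum>t. ennreal (real (8 * (8 * (n - 1 + t) + 9)) * gain_factor a l R p n (n - 1 + t)) * ?Z)"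
    by (intro suminf_le summableI T(2)) simp
  also have "\<dots> = (\<Sum>t. ennreal (real (8 * (8 * (n - 1 + t) + 9)) * gain_factor a l R p n (n - 1 + t))) * ?Z"
    by simp
  also have "\<dots> \<le> ennreal \<epsilon> * ?Z" by (intro mult_right_mono sm) simp
  finally show ?thesis .
qed

text \<open>If the partition function is 0 or infinite, then \<open>laughlin_prob\<close> is 0, because \<open>measure\<close>
  is 0 where \<open>emeasure\<close> is infinite and division by 0 gives 0.\<close>

lemma laughlin_prob_le:
  assumes "0 \<le> \<epsilon>" and "emeasure (laughlin_unnorm R l p N) A \<le>
    ennreal \<epsilon> * emeasure (laughlin_unnorm R l p N) (space (base_measure N))"
  shows "laughlin_prob R l p N A \<le> \<epsilon>"
proof -
  let ?Z = "emeasure (laughlin_unnorm R l p N) (space (base_measure N))"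
  show ?thesis
  proof (cases "?Z = 0 \<or> ?Z = \<infinity>")
    case True
    hence "measure (laughlin_unnorm R l p N) (space (base_measure N)) = 0" by (auto simp: measure_def)
    thus ?thesis using assms(1) by (simp add: laughlin_prob_def)
  next
    case False
    hence Z: "0 < enn2real ?Z" by (auto simp: enn2real_positive_iff less_top zero_less_iff_neq_zero)
    have "enn2real (emeasure (laughlin_unnorm R l p N) A) \<le> enn2real (ennreal \<epsilon> * ?Z)"
      using assms(2) False by (intro enn2real_mono) (auto simp: ennreal_mult_less_top less_top)
    also have "\<dots> = \<epsilon> * enn2real ?Z" using assms(1) by (simp add: enn2real_mult)
    finally show ?thesis using Z by (simp add: laughlin_prob_def measure_def field_simps)
  qed
qed

theorem theorem5p4:
  fixes R l :: real and p :: nat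
  assumes "R > 0" and "l > 0" and "p \<ge> 1"
  shows "\<exists>C c. C > 0 \<and> c > 0 \<and>
    (\<forall>N k n. N \<ge> 2 \<longrightarrow> 1 \<le> k \<longrightarrow> k \<le> N - 1 \<longrightarrow>
      laughlin_prob R l p N
        {z \<in> space (base_measure N).
           \<bar>particle_excess N k ((real k - 1/2) * real p * l\<^sup>2 / R) z\<bar> \<ge> int n}
      \<le> C * exp (- c * real n ^ 3))"
proof -
  define a where "a = real p * l\<^sup>2 / R"
  have a: "a > 0" using assms by (simp add: a_def)
  define K where "K = 128 * real p * crowd_const a R * a + 8"
  \<comment> \<open>As n div 2 >= n / 3 for n >= 2, the energy term is at least 2 c n; one c n is
    given up to pay for \<open>K\<close>.\<close>
  define c where "c = a\<^sup>2 / (64 * l\<^sup>2)"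
  have c: "c > 0" using a assms by (simp add: c_def)
  \<comment> \<open>The thresholds make c n exceed \<open>K\<close>, make c n at least 2 for the
    summation over q, and let q >= n - 1 beat the crowding constant.\<close>
  define M where "M = max (K / c) (max (2 / c) (1 + 32 * real p * crowd_const a R * l\<^sup>2 / (3 * a)))"
  define n0 where "n0 = max 2 (nat \<lceil>M\<rceil>)"
  have n0: "M \<le> real n0" unfolding n0_def by linarith
  have large: "laughlin_prob R l p N {z \<in> space (base_measure N).
        \<bar>particle_excess N k ((real k - 1/2) * real p * l\<^sup>2 / R) z\<bar> \<ge> int n}
      \<le> 272 * exp (- (c / 8) * real n ^ 3)" if k: "1 \<le> k" "k \<le> N - 1" and n: "n0 \<le> n" for N k n
  proof -
    have n2: "2 \<le> n" using n by (simp add: n0_def)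
    have nM: "M \<le> real n" using n n0 by (meson of_nat_le_iff order_trans)
    hence nK: "K / c \<le> real n" "2 / c \<le> real n" "1 + 32 * real p * crowd_const a R * l\<^sup>2 / (3 * a) \<le> real n"
      by (auto simp: M_def)
    have big: "2 * real p * crowd_const a R \<le> 3 * real q * a / (16 * l\<^sup>2)" if "n \<le> q + 1" for q
    proof -
      have "real n \<le> real q + 1" using that by linarith
      hence "32 * real p * crowd_const a R * l\<^sup>2 / (3 * a) \<le> real q" using nK(3) by linarith
      thus ?thesis using a assms by (simp add: field_simps)
    qed
    have gain: "gain_factor a l R p n q \<le> exp (- (c * real n * (real q)\<^sup>2))" for q
    proof -
      have "n \<le> 3 * (n div 2)" using n2 by linarith
      hence "real n \<le> 3 * real (n div 2)" by linarith
      hence "2 * c * real n \<le> 2 * c * (3 * real (n div 2))" using c by (intro mult_left_mono) auto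
      also have "\<dots> = 3 * a\<^sup>2 * real (n div 2) / (32 * l\<^sup>2)" by (simp add: c_def)
      finally have "2 * c * real n \<le> 3 * a\<^sup>2 * real (n div 2) / (32 * l\<^sup>2)" .
      moreover have "K \<le> c * real n" using nK(1) c by (simp add: field_simps)
      ultimately have "c * real n \<le> 3 * a\<^sup>2 * real (n div 2) / (32 * l\<^sup>2) - K" by linarith
      hence "(real q)\<^sup>2 * (c * real n) \<le> (real q)\<^sup>2 * (3 * a\<^sup>2 * real (n div 2) / (32 * l\<^sup>2) - K)"
        by (intro mult_left_mono) auto
      thus ?thesis by (simp add: gain_factor_def K_def ac_simps)
    qed
    note sm = gain_factor_sum[OF c n2 nK(2) gain]
    have "laughlin_prob R l p N {z \<in> space (base_measure N).
        \<bar>particle_excess N k ((real k - 1/2) * a) z\<bar> \<ge> int n} \<le> 272 * exp (- (c / 8) * real n ^ 3)"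
      by (rule laughlin_prob_le[OF _ particle_excess_emeasure[OF assms(1,2) a_def assms(3) k n2 big sm]]) auto
    thus ?thesis by (simp add: a_def mult.assoc)
  qed
  have trivial: "laughlin_prob R l p N A \<le> 1" if "A \<subseteq> space (base_measure N)" for N A
    by (intro laughlin_prob_le) (auto intro!: emeasure_mono that simp: laughlin_unnorm_def)
  \<comment> \<open>For n below \<open>n0\<close> the second summand lifts the claimed bound above
    1, where it is trivial.\<close>
  define C where "C = 272 + exp (c / 8 * real n0 ^ 3)"
  have "laughlin_prob R l p N {z \<in> space (base_measure N).
        \<bar>particle_excess N k ((real k - 1/2) * real p * l\<^sup>2 / R) z\<bar> \<ge> int n}
      \<le> C * exp (- (c / 8) * real n ^ 3)" (is "?P \<le> _") if k: "1 \<le> k" "k \<le> N - 1" for N k n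
  proof (cases "n0 \<le> n")
    case True
    have "?P \<le> 272 * exp (- (c / 8) * real n ^ 3)" by (rule large[OF k True])
    also have "\<dots> \<le> C * exp (- (c / 8) * real n ^ 3)" by (intro mult_right_mono) (auto simp: C_def)
    finally show ?thesis .
  next
    case False
    have "?P \<le> 1" by (rule trivial) auto
    also have "1 \<le> exp (c / 8 * real n0 ^ 3) * exp (- (c / 8) * real n ^ 3)"
    proof -
      have "real n ^ 3 \<le> real n0 ^ 3" using False by (intro power_mono) auto
      hence "c / 8 * real n ^ 3 \<le> c / 8 * real n0 ^ 3" using c by (intro mult_left_mono) auto
      thus ?thesis by (simp flip: exp_add)
    qed
    also have "\<dots> \<le> C * exp (- (c / 8) * real n ^ 3)" by (intro mult_right_mono) (auto simp: C_def)
    finally show ?thesis .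
  qed
  moreover have "C > 0" by (simp add: C_def add_pos_pos)
  ultimately show ?thesis using c by (intro exI[of _ C] exI[of _ "c / 8"]) auto
qed

end
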